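(* Let $\Lambda=kQ/I$ be a Koszul algebra over some field $k$, where $Q$ is a finite quiver and $I\subseteq J^2$. Denote by $\{f^n_i\}_{i=0}^{t_n}$ elements in $kQ$ defining a minimal projective resolution $(\mathbb F,e)$ of $\Lambda/\mathfrak r$ as a right module over $\Lambda$, with elements $c_{pq}(n,i,r)\in k$ giving their comultiplicative structure. Let the elements $\widehat f^n_i\colon F^n\to\Lambda/\mathfrak r$ for $i=0,1,\ldots,t_n$ be given by $\widehat f^n_i(\overline{f^n_j})=\delta_{ij}\mathfrak t(f^n_i)$ for all $j=0,1,\ldots,t_n$. The set $\{\widehat f^n_i\}_{i=0}^{t_n}$ represents a $k$-basis of $\mathrm{Ext}^n_\Lambda(\Lambda/\mathfrak r,\Lambda/\mathfrak r)$. Then the product $\widehat f^m_i\widehat f^n_j$ in $\mathrm{Ext}^*_\Lambda(\Lambda/\mathfrak r,\Lambda/\mathfrak r)$ of the two elements $\widehat f^m_i$ and $\widehat f^n_j$, in degree $m$ and $n$ respectively, is given by \[\widehat f^m_i\,\widehat f^n_j=\sum_{l=0}^{t_{m+n}}c_{ji}(m+n,l,n)\,\widehat f^{m+n}_l.\]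
   Context: Setting. $R=kQ$ is the path algebra of the finite quiver $Q$ (paths are composed left to right), $J$ is the ideal of $kQ$ generated by the arrows, $I\subseteq J^2$ is an ideal, $\Lambda=kQ/I$ and $\mathfrak r=J/I$. $\Lambda$ is Koszul: $I$ is homogeneous for path length, and in the minimal graded projective resolution of $\Lambda/\mathfrak r$ the $n$-th term is generated in degree $n$. Modules are right modules. A nonzero $x\in kQ$ is uniform if $x=uxv$ for vertices $u,v$; then $\mathfrak o(x)=u$ and $\mathfrak t(x)=v$. The set $\{f^n_i\}$ defines a minimal projective resolution $(\mathbb F,e)$ of $\Lambda/\mathfrak r$ as a right $\Lambda$-module if, for integers $t_n$ ($n\ge0$), the $f^n_i$ ($0\le i\le t_n$) are uniform elements of $R$; for each $n$ the sum $\sum_i f^n_iR$ is direct, written $\amalg_{i=0}^{t_n}f^n_iR$; there is a chain of right ideals $\cdots\subseteq\amalg_{i=0}^{t_n}f^n_iR\subseteq\amalg_{i=0}^{t_{n-1}}f^{n-1}_iR\subseteq\cdots\subseteq\amalg_{i=0}^{t_0}f^0_iR=R$; and the modules $F^n=\amalg_{i=0}^{t_n}f^n_iR/\amalg_{i=0}^{t_n}f^n_iI$, with differentials $e^n\colon F^n\to F^{n-1}$ induced by the inclusions, form a minimal projective resolution of $\Lambda/\mathfrak r$. Here $\{f^0_i\}$ is the set of vertices, $\{f^1_i\}$ is the set of arrows, $\{f^2_i\}$ is a minimal set of homogeneous generators of degree two for $I$, and each $f^n_i$ is a linear combination of paths of length $n$. $\overline{f^n_j}$ denotes the residue class of $f^n_j$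 in $F^n$; $\delta_{ij}$ is the Kronecker delta; the vertex $\mathfrak t(f^n_i)$ is viewed in $\Lambda/\mathfrak r$. Comultiplicative structure: it is known that there are elements $c_{pq}(n,i,r)\in k$ such that \[f^n_i=\sum_{p=0}^{t_r}\sum_{q=0}^{t_{n-r}}c_{pq}(n,i,r)f^r_pf^{n-r}_q\] for all $n\ge1$, all $i\in\{0,1,\ldots,t_n\}$ and all $r\in\{0,1,\ldots,n\}$; for $n=0$ the coefficients $c_{pq}(0,i,0)$ are read from the same equation, i.e. from $f^0_i=f^0_if^0_i$. The product on $\mathrm{Ext}^*_\Lambda(\Lambda/\mathfrak r,\Lambda/\mathfrak r)$ is the Yoneda product: for $x$ of degree $m$ and $y$ of degree $n$ represented by $x\colon F^m\to\Lambda/\mathfrak r$ and $y\colon F^n\to\Lambda/\mathfrak r$, lift $y$ to homomorphisms $g_r\colon F^{n+r}\to F^r$ ($r\ge0$) such that $g_0$ followed by the augmentation $F^0\to\Lambda/\mathfrak r$ equals $y$ and $g_re^{n+r+1}=e^{r+1}g_{r+1}$ for all $r\ge0$; then $xy$ is represented by $xg_m$.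
   Formalization: The coefficients c_{pq}(n,i,r) are additionally required to be 0 whenever f^r_p f^{n-r}_q = 0; the defining equation leaves them arbitrary there, and the product formula fails for nonzero choices. *)

theory Defs
  imports
    "HOL-Library.Poly_Mapping"
    "HOL-Library.FuncSet"
    "Graph_Theory.Arc_Walk"
    "HOL-Algebra.Algebra"
begin

section \<open>Path algebras\<close>

text \<open>
  A quiver is a \<^locale>\<open>pre_digraph\<close> (loops and parallel arcs are allowed); it is finite if it
  is a \<^locale>\<open>fin_digraph\<close>.  A path is a pair of its start vertex and its list of arrows, so
  that there is one trivial path for each vertex.
\<close>

type_synonym ('v, 'a) qpath = "'v \<times> 'a list"

definition path_end :: "('v, 'a) pre_digraph \<Rightarrow> ('v, 'a) qpath \<Rightarrow> 'v" where
  "path_end Q p = pre_digraph.awlast Q (fst p) (snd p)"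

definition quiver_paths :: "('v, 'a) pre_digraph \<Rightarrow> ('v, 'a) qpath set" where
  "quiver_paths Q = {p. pre_digraph.awalk Q (fst p) (snd p) (path_end Q p)}"

definition path_algebra ::
    "('v, 'a) pre_digraph \<Rightarrow> (('v, 'a) qpath \<Rightarrow>\<^sub>0 'k::field) ring" where
  "path_algebra Q =
    \<lparr>carrier = {x. Poly_Mapping.keys x \<subseteq> quiver_paths Q},
     monoid.mult = (\<lambda>x y. \<Sum>p\<in>Poly_Mapping.keys x. \<Sum>q\<in>Poly_Mapping.keys y.
        if path_end Q p = fst q
        then Poly_Mapping.single (fst p, snd p @ snd q)
               (Poly_Mapping.lookup x p * Poly_Mapping.lookup y q)
        else 0),
     one = (\<Sum>v\<in>verts Q. Poly_Mapping.single (v, []) 1),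
     ring.zero = 0,
     ring.add = (+)\<rparr>"

definition vertex_elt :: "'v \<Rightarrow> (('v, 'a) qpath \<Rightarrow>\<^sub>0 'k::field)" where
  "vertex_elt v = Poly_Mapping.single (v, []) 1"

definition arrow_elt :: "('v, 'a) pre_digraph \<Rightarrow> 'a \<Rightarrow> (('v, 'a) qpath \<Rightarrow>\<^sub>0 'k::field)" where
  "arrow_elt Q a = Poly_Mapping.single (tail Q a, [a]) 1"

definition pa_scale :: "'k \<Rightarrow> ('p \<Rightarrow>\<^sub>0 'k) \<Rightarrow> ('p \<Rightarrow>\<^sub>0 'k::field)" where
  "pa_scale c x = Poly_Mapping.map (\<lambda>a. c * a) x"

definition arrow_ideal ::
    "('v, 'a) pre_digraph \<Rightarrow> (('v, 'a) qpath \<Rightarrow>\<^sub>0 'k::field) set" where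
  "arrow_ideal Q = Idl\<^bsub>path_algebra Q\<^esub> (arrow_elt Q ` arcs Q)"

definition homogeneous_of_length ::
    "nat \<Rightarrow> (('v, 'a) qpath \<Rightarrow>\<^sub>0 'k::field) \<Rightarrow> bool" where
  "homogeneous_of_length d x \<longleftrightarrow> (\<forall>p\<in>Poly_Mapping.keys x. length (snd p) = d)"

definition length_component ::
    "nat \<Rightarrow> (('v, 'a) qpath \<Rightarrow>\<^sub>0 'k::field) \<Rightarrow> (('v, 'a) qpath \<Rightarrow>\<^sub>0 'k)" where
  "length_component d x =
    (\<Sum>p\<in>{p \<in> Poly_Mapping.keys x. length (snd p) = d}.
       Poly_Mapping.single p (Poly_Mapping.lookup x p))"

definition length_homogeneous_ideal :: "(('v, 'a) qpath \<Rightarrow>\<^sub>0 'k::field) set \<Rightarrow> bool" where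
  "length_homogeneous_ideal I \<longleftrightarrow> (\<forall>x\<in>I. \<forall>d. length_component d x \<in> I)"

definition uniform_between :: "('v, 'a) pre_digraph \<Rightarrow> (('v, 'a) qpath \<Rightarrow>\<^sub>0 'k::field)
    \<Rightarrow> 'v \<Rightarrow> 'v \<Rightarrow> bool" where
  "uniform_between Q x u v \<longleftrightarrow>
    x \<in> carrier (path_algebra Q) \<and> x \<noteq> 0 \<and> u \<in> verts Q \<and> v \<in> verts Q \<and>
    x = vertex_elt u \<otimes>\<^bsub>path_algebra Q\<^esub> x \<otimes>\<^bsub>path_algebra Q\<^esub> vertex_elt v"

definition uniform :: "('v, 'a) pre_digraph \<Rightarrow> (('v, 'a) qpath \<Rightarrow>\<^sub>0 'k::field) \<Rightarrow> bool" where
  "uniform Q x \<longleftrightarrow> (\<exists>u v. uniform_between Q x u v)"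

definition terminus :: "('v, 'a) pre_digraph \<Rightarrow> (('v, 'a) qpath \<Rightarrow>\<^sub>0 'k::field) \<Rightarrow> 'v" where
  "terminus Q x = (THE v. \<exists>u. uniform_between Q x u v)"


section \<open>Right modules\<close>

text \<open>
  The library's \<^locale>\<open>module\<close> is restricted to commutative rings.  Its record type is reused
  here for right modules over arbitrary rings: the term \<open>a \<odot>\<^bsub>M\<^esub> x\<close> denotes the
  \<^emph>\<open>right\<close> action of \<open>a\<close> on \<open>x\<close>, usually written \<open>xa\<close>.  The fields \<^const>\<open>monoid.mult\<close> and
  \<^const>\<open>one\<close> of a module are irrelevant.
\<close>

locale right_module = R?: ring R + M?: abelian_group M
  for R :: "('r, 'm) ring_scheme" (structure) and M :: "('r, 'b, 'n) module_scheme" (structure) +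
  assumes act_closed:
      "\<lbrakk>a \<in> carrier R; x \<in> carrier M\<rbrakk> \<Longrightarrow> a \<odot>\<^bsub>M\<^esub> x \<in> carrier M"
    and act_scalar_distr:
      "\<lbrakk>a \<in> carrier R; b \<in> carrier R; x \<in> carrier M\<rbrakk> \<Longrightarrow>
       (a \<oplus>\<^bsub>R\<^esub> b) \<odot>\<^bsub>M\<^esub> x = a \<odot>\<^bsub>M\<^esub> x \<oplus>\<^bsub>M\<^esub> b \<odot>\<^bsub>M\<^esub> x"
    and act_distr:
      "\<lbrakk>a \<in> carrier R; x \<in> carrier M; y \<in> carrier M\<rbrakk> \<Longrightarrow>
       a \<odot>\<^bsub>M\<^esub> (x \<oplus>\<^bsub>M\<^esub> y) = a \<odot>\<^bsub>M\<^esub> x \<oplus>\<^bsub>M\<^esub> a \<odot>\<^bsub>M\<^esub> y"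
    and act_assoc:
      "\<lbrakk>a \<in> carrier R; b \<in> carrier R; x \<in> carrier M\<rbrakk> \<Longrightarrow>
       (a \<otimes>\<^bsub>R\<^esub> b) \<odot>\<^bsub>M\<^esub> x = b \<odot>\<^bsub>M\<^esub> (a \<odot>\<^bsub>M\<^esub> x)"
    and act_one:
      "x \<in> carrier M \<Longrightarrow> \<one>\<^bsub>R\<^esub> \<odot>\<^bsub>M\<^esub> x = x"

text \<open>Homomorphisms are extensional, so that equality of homomorphisms is equality of functions.\<close>

definition right_hom ::
    "('r, 'm) ring_scheme \<Rightarrow> ('r, 'b) module \<Rightarrow> ('r, 'c) module \<Rightarrow> ('b \<Rightarrow> 'c) set" where
  "right_hom R M N = {h \<in> carrier M \<rightarrow>\<^sub>E carrier N.
     (\<forall>x\<in>carrier M. \<forall>y\<in>carrier M. h (x \<oplus>\<^bsub>M\<^esub> y) = h x \<oplus>\<^bsub>N\<^esub> h y) \<and>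
     (\<forall>a\<in>carrier R. \<forall>x\<in>carrier M. h (a \<odot>\<^bsub>M\<^esub> x) = a \<odot>\<^bsub>N\<^esub> h x)}"

definition right_submodule ::
    "('r, 'm) ring_scheme \<Rightarrow> ('r, 'b) module \<Rightarrow> 'b set \<Rightarrow> bool" where
  "right_submodule R M U \<longleftrightarrow>
    additive_subgroup U M \<and> (\<forall>a\<in>carrier R. \<forall>x\<in>U. a \<odot>\<^bsub>M\<^esub> x \<in> U)"

definition right_span ::
    "('r, 'm) ring_scheme \<Rightarrow> ('r, 'b) module \<Rightarrow> 'b set \<Rightarrow> 'b set" where
  "right_span R M B = \<Inter>{U. right_submodule R M U \<and> B \<subseteq> U}"

text \<open>The submodule \<open>M\<aa>\<close> of a right module \<open>M\<close>, for an ideal \<open>\<aa>\<close>.\<close>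

definition module_times_ideal ::
    "('r, 'm) ring_scheme \<Rightarrow> ('r, 'b) module \<Rightarrow> 'r set \<Rightarrow> 'b set" where
  "module_times_ideal R M \<aa> = right_span R M {a \<odot>\<^bsub>M\<^esub> x |a x. a \<in> \<aa> \<and> x \<in> carrier M}"

definition free_right_module ::
    "('r, 'm) ring_scheme \<Rightarrow> 'x set \<Rightarrow> ('r, 'x \<Rightarrow> 'r) module" where
  "free_right_module R B =
    \<lparr>carrier = {u \<in> B \<rightarrow>\<^sub>E carrier R. finite {x \<in> B. u x \<noteq> \<zero>\<^bsub>R\<^esub>}},
     monoid.mult = undefined, one = undefined,
     ring.zero = (\<lambda>x\<in>B. \<zero>\<^bsub>R\<^esub>),
     ring.add = (\<lambda>u w. \<lambda>x\<in>B. u x \<oplus>\<^bsub>R\<^esub> w x),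
     smult = (\<lambda>a u. \<lambda>x\<in>B. u x \<otimes>\<^bsub>R\<^esub> a)\<rparr>"

text \<open>
  Projective means direct summand of a free module.  Restricting to bases \<open>B\<close> in the type of the
  elements of \<open>P\<close> loses nothing, because \<open>P\<close> is a quotient of the free module on its carrier.
\<close>

definition projective_right_module ::
    "('r, 'm) ring_scheme \<Rightarrow> ('r, 'b) module \<Rightarrow> bool" where
  "projective_right_module R P \<longleftrightarrow> right_module R P \<and>
    (\<exists>B :: 'b set. \<exists>s \<in> right_hom R P (free_right_module R B).
       \<exists>p \<in> right_hom R (free_right_module R B) P. \<forall>x\<in>carrier P. p (s x) = x)"

text \<open>
  The differential \<open>d n\<close> goes from \<open>P n\<close> to \<open>P (n - 1)\<close>, for \<open>n \<ge> 1\<close>; the value \<open>d 0\<close> is not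
  used.  The resolution is minimal with respect to the ideal \<open>\<rr>\<close>, that is, the image of each
  differential lies in \<open>P (n - 1) \<rr>\<close>.
\<close>

definition minimal_projective_resolution ::
    "('r, 'm) ring_scheme \<Rightarrow> 'r set \<Rightarrow> (nat \<Rightarrow> ('r, 'b) module) \<Rightarrow> (nat \<Rightarrow> 'b \<Rightarrow> 'b)
      \<Rightarrow> ('b \<Rightarrow> 'c) \<Rightarrow> ('r, 'c) module \<Rightarrow> bool" where
  "minimal_projective_resolution R \<rr> P d \<epsilon> N \<longleftrightarrow>
     right_module R N \<and>
     (\<forall>n. projective_right_module R (P n)) \<and>
     (\<forall>n. d (Suc n) \<in> right_hom R (P (Suc n)) (P n)) \<and>
     \<epsilon> \<in> right_hom R (P 0) N \<and>
     \<epsilon> ` carrier (P 0) = carrier N \<and>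
     d (Suc 0) ` carrier (P (Suc 0)) = a_kernel (P 0) N \<epsilon> \<and>
     (\<forall>n. d (Suc (Suc n)) ` carrier (P (Suc (Suc n))) = a_kernel (P (Suc n)) (P n) (d (Suc n))) \<and>
     (\<forall>n. d (Suc n) ` carrier (P (Suc n)) \<subseteq> module_times_ideal R (P n) \<rr>)"


section \<open>Ext and the Yoneda product\<close>

text \<open>
  In this section \<open>R\<close> is a \<open>k\<close>-algebra with structure map \<open>\<iota>\<close> from \<open>k\<close> to the centre of \<open>R\<close>, and
  \<open>(F, e, \<epsilon>)\<close> is a projective resolution of the right module \<open>N\<close>.
\<close>

definition hom_space :: "('k \<Rightarrow> 'r) \<Rightarrow> ('r, 'm) ring_scheme \<Rightarrow> ('r, 'b) module
    \<Rightarrow> ('r, 'c) module \<Rightarrow> ('k, 'b \<Rightarrow> 'c) module" where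
  "hom_space \<iota> R M N =
    \<lparr>carrier = right_hom R M N, monoid.mult = undefined, one = undefined,
     ring.zero = (\<lambda>x\<in>carrier M. \<zero>\<^bsub>N\<^esub>),
     ring.add = (\<lambda>g h. \<lambda>x\<in>carrier M. g x \<oplus>\<^bsub>N\<^esub> h x),
     smult = (\<lambda>c h. \<lambda>x\<in>carrier M. \<iota> c \<odot>\<^bsub>N\<^esub> h x)\<rparr>"

definition cocycles :: "('r, 'm) ring_scheme \<Rightarrow> (nat \<Rightarrow> ('r, 'b) module) \<Rightarrow> (nat \<Rightarrow> 'b \<Rightarrow> 'b)
    \<Rightarrow> ('r, 'c) module \<Rightarrow> nat \<Rightarrow> ('b \<Rightarrow> 'c) set" where
  "cocycles R F e N n = {x \<in> right_hom R (F n) N.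
     \<forall>z\<in>carrier (F (Suc n)). x (e (Suc n) z) = \<zero>\<^bsub>N\<^esub>}"

definition coboundaries :: "('r, 'm) ring_scheme \<Rightarrow> (nat \<Rightarrow> ('r, 'b) module)
    \<Rightarrow> (nat \<Rightarrow> 'b \<Rightarrow> 'b) \<Rightarrow> ('r, 'c) module \<Rightarrow> nat \<Rightarrow> ('b \<Rightarrow> 'c) set" where
  "coboundaries R F e N n = (case n of
       0 \<Rightarrow> {\<lambda>x\<in>carrier (F 0). \<zero>\<^bsub>N\<^esub>}
     | Suc l \<Rightarrow> {compose (carrier (F (Suc l))) y (e (Suc l)) |y. y \<in> right_hom R (F l) N})"

definition ext_class :: "('k \<Rightarrow> 'r) \<Rightarrow> ('r, 'm) ring_scheme \<Rightarrow> (nat \<Rightarrow> ('r, 'b) module)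
    \<Rightarrow> (nat \<Rightarrow> 'b \<Rightarrow> 'b) \<Rightarrow> ('r, 'c) module \<Rightarrow> nat \<Rightarrow> ('b \<Rightarrow> 'c) \<Rightarrow> ('b \<Rightarrow> 'c) set" where
  "ext_class \<iota> R F e N n x = coboundaries R F e N n +>\<^bsub>hom_space \<iota> R (F n) N\<^esub> x"

definition ext_space :: "('k \<Rightarrow> 'r) \<Rightarrow> ('r, 'm) ring_scheme \<Rightarrow> (nat \<Rightarrow> ('r, 'b) module)
    \<Rightarrow> (nat \<Rightarrow> 'b \<Rightarrow> 'b) \<Rightarrow> ('r, 'c) module \<Rightarrow> nat \<Rightarrow> ('k, ('b \<Rightarrow> 'c) set) module" where
  "ext_space \<iota> R F e N n =
    \<lparr>carrier = ext_class \<iota> R F e N n ` cocycles R F e N n,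
     monoid.mult = undefined, one = undefined,
     ring.zero = coboundaries R F e N n,
     ring.add = set_add (hom_space \<iota> R (F n) N),
     smult = (\<lambda>c A. \<Union>x\<in>A. ext_class \<iota> R F e N n (c \<odot>\<^bsub>hom_space \<iota> R (F n) N\<^esub> x))\<rparr>"

text \<open>Chain maps \<open>g r\<close> from \<open>F (n + r)\<close> to \<open>F r\<close> that lift \<open>y\<close>.\<close>

definition liftings :: "('r, 'm) ring_scheme \<Rightarrow> (nat \<Rightarrow> ('r, 'b) module) \<Rightarrow> (nat \<Rightarrow> 'b \<Rightarrow> 'b)
    \<Rightarrow> ('b \<Rightarrow> 'c) \<Rightarrow> nat \<Rightarrow> ('b \<Rightarrow> 'c) \<Rightarrow> (nat \<Rightarrow> 'b \<Rightarrow> 'b) set" where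
  "liftings R F e \<epsilon> n y = {g.
     (\<forall>r. g r \<in> right_hom R (F (n + r)) (F r)) \<and>
     (\<forall>z\<in>carrier (F n). \<epsilon> (g 0 z) = y z) \<and>
     (\<forall>r. \<forall>z\<in>carrier (F (n + r + 1)). g r (e (n + r + 1) z) = e (r + 1) (g (r + 1) z))}"

text \<open>
  The product of \<open>A\<close> in degree \<open>m\<close> and \<open>B\<close> in degree \<open>n\<close>.  As for \<^const>\<open>rcoset_mult\<close>, the union
  runs over all choices: all representatives of \<open>A\<close> and \<open>B\<close> and all liftings.  It is a single
  class exactly because the product does not depend on them.
\<close>

definition yoneda_product :: "('k \<Rightarrow> 'r) \<Rightarrow> ('r, 'm) ring_scheme \<Rightarrow> (nat \<Rightarrow> ('r, 'b) module)
    \<Rightarrow> (nat \<Rightarrow> 'b \<Rightarrow> 'b) \<Rightarrow> ('b \<Rightarrow> 'c) \<Rightarrow> ('r, 'c) module \<Rightarrow> nat \<Rightarrow> nat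
    \<Rightarrow> ('b \<Rightarrow> 'c) set \<Rightarrow> ('b \<Rightarrow> 'c) set \<Rightarrow> ('b \<Rightarrow> 'c) set" where
  "yoneda_product \<iota> R F e \<epsilon> N m n A B =
    (\<Union>x\<in>A. \<Union>y\<in>B. \<Union>g\<in>liftings R F e \<epsilon> n y.
       ext_class \<iota> R F e N (m + n) (compose (carrier (F (m + n))) x (g m)))"

definition is_basis :: "('k::field, 'b) module \<Rightarrow> 'i set \<Rightarrow> ('i \<Rightarrow> 'b) \<Rightarrow> bool" where
  "is_basis V A b \<longleftrightarrow> finite A \<and> b ` A \<subseteq> carrier V \<and>
    (\<forall>\<alpha>. (\<Oplus>\<^bsub>V\<^esub>i\<in>A. \<alpha> i \<odot>\<^bsub>V\<^esub> b i) = \<zero>\<^bsub>V\<^esub> \<longrightarrow> (\<forall>i\<in>A. \<alpha> i = 0)) \<and>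
    (\<forall>x\<in>carrier V. \<exists>\<alpha>. x = (\<Oplus>\<^bsub>V\<^esub>i\<in>A. \<alpha> i \<odot>\<^bsub>V\<^esub> b i))"


section \<open>The algebra \<open>\<Lambda> = kQ/I\<close> and Koszulity\<close>

definition quiver_algebra :: "('v, 'a) pre_digraph \<Rightarrow> (('v, 'a) qpath \<Rightarrow>\<^sub>0 'k::field) set
    \<Rightarrow> (('v, 'a) qpath \<Rightarrow>\<^sub>0 'k) set ring" where
  "quiver_algebra Q I = path_algebra Q Quot I"

definition quiver_radical :: "('v, 'a) pre_digraph \<Rightarrow> (('v, 'a) qpath \<Rightarrow>\<^sub>0 'k::field) set
    \<Rightarrow> (('v, 'a) qpath \<Rightarrow>\<^sub>0 'k) set set" where
  "quiver_radical Q I = (\<lambda>x. I +>\<^bsub>path_algebra Q\<^esub> x) ` arrow_ideal Q"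

definition algebra_scalar :: "('v, 'a) pre_digraph \<Rightarrow> (('v, 'a) qpath \<Rightarrow>\<^sub>0 'k::field) set
    \<Rightarrow> 'k \<Rightarrow> (('v, 'a) qpath \<Rightarrow>\<^sub>0 'k) set" where
  "algebra_scalar Q I c = I +>\<^bsub>path_algebra Q\<^esub> pa_scale c \<one>\<^bsub>path_algebra Q\<^esub>"

text \<open>\<open>\<Lambda>/\<rr>\<close> as a right \<open>\<Lambda>\<close>-module.\<close>

definition top_module :: "('v, 'a) pre_digraph \<Rightarrow> (('v, 'a) qpath \<Rightarrow>\<^sub>0 'k::field) set
    \<Rightarrow> ((('v, 'a) qpath \<Rightarrow>\<^sub>0 'k) set, (('v, 'a) qpath \<Rightarrow>\<^sub>0 'k) set set) module" where
  "top_module Q I =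
    \<lparr>carrier = carrier (quiver_algebra Q I Quot quiver_radical Q I),
     monoid.mult = undefined, one = undefined,
     ring.zero = \<zero>\<^bsub>quiver_algebra Q I Quot quiver_radical Q I\<^esub>,
     ring.add = ring.add (quiver_algebra Q I Quot quiver_radical Q I),
     smult = (\<lambda>a m. \<Union>b\<in>m. quiver_radical Q I +>\<^bsub>quiver_algebra Q I\<^esub> (b \<otimes>\<^bsub>quiver_algebra Q I\<^esub> a))\<rparr>"

definition top_proj :: "('v, 'a) pre_digraph \<Rightarrow> (('v, 'a) qpath \<Rightarrow>\<^sub>0 'k::field) set
    \<Rightarrow> (('v, 'a) qpath \<Rightarrow>\<^sub>0 'k) set \<Rightarrow> (('v, 'a) qpath \<Rightarrow>\<^sub>0 'k) set set" where
  "top_proj Q I =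
    (\<lambda>a\<in>carrier (quiver_algebra Q I). quiver_radical Q I +>\<^bsub>quiver_algebra Q I\<^esub> a)"

definition algebra_degree :: "('v, 'a) pre_digraph \<Rightarrow> (('v, 'a) qpath \<Rightarrow>\<^sub>0 'k::field) set
    \<Rightarrow> nat \<Rightarrow> (('v, 'a) qpath \<Rightarrow>\<^sub>0 'k) set set" where
  "algebra_degree Q I d =
    {I +>\<^bsub>path_algebra Q\<^esub> x |x. x \<in> carrier (path_algebra Q) \<and> homogeneous_of_length d x}"

definition graded_right_module :: "('r, 'm) ring_scheme \<Rightarrow> (nat \<Rightarrow> 'r set)
    \<Rightarrow> ('r, 'b) module \<Rightarrow> (int \<Rightarrow> 'b set) \<Rightarrow> bool" where
  "graded_right_module R D M G \<longleftrightarrow>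
     right_module R M \<and>
     (\<forall>k. additive_subgroup (G k) M) \<and>
     (\<forall>k d. \<forall>x\<in>G k. \<forall>a\<in>D d. a \<odot>\<^bsub>M\<^esub> x \<in> G (k + int d)) \<and>
     (\<forall>x\<in>carrier M. \<exists>!u. (\<forall>k. u k \<in> G k) \<and> finite {k. u k \<noteq> \<zero>\<^bsub>M\<^esub>} \<and>
        x = (\<Oplus>\<^bsub>M\<^esub>k\<in>{k. u k \<noteq> \<zero>\<^bsub>M\<^esub>}. u k))"

text \<open>
  The terms of the resolution are arbitrary graded modules with elements in the type of sequences
  in \<open>\<Lambda>\<close>.  This type is large enough: if \<open>Q\<close> is finite then \<open>\<Lambda>\<close> is locally finite, so each term
  of the minimal graded projective resolution of \<open>\<Lambda>/\<rr>\<close> embeds into a countable direct sum of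
  copies of \<open>\<Lambda>\<close>.  The module \<open>\<Lambda>/\<rr>\<close> is concentrated in degree 0.
\<close>

definition koszul_algebra ::
    "('v, 'a) pre_digraph \<Rightarrow> (('v, 'a) qpath \<Rightarrow>\<^sub>0 'k::field) set \<Rightarrow> bool" where
  "koszul_algebra Q I \<longleftrightarrow> length_homogeneous_ideal I \<and>
    (\<exists>(P :: nat \<Rightarrow> ((('v, 'a) qpath \<Rightarrow>\<^sub>0 'k) set, nat \<Rightarrow> (('v, 'a) qpath \<Rightarrow>\<^sub>0 'k) set) module)
       G d \<epsilon>.
       minimal_projective_resolution (quiver_algebra Q I) (quiver_radical Q I) P d \<epsilon>
         (top_module Q I) \<and>
       (\<forall>n. graded_right_module (quiver_algebra Q I) (algebra_degree Q I) (P n) (G n)) \<and>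
       (\<forall>n k. d (Suc n) ` G (Suc n) k \<subseteq> G n k) \<and>
       (\<forall>k. k \<noteq> 0 \<longrightarrow> \<epsilon> ` G 0 k \<subseteq> {\<zero>\<^bsub>top_module Q I\<^esub>}) \<and>
       (\<forall>n. right_span (quiver_algebra Q I) (P n) (G n (int n)) = carrier (P n)))"


section \<open>Resolutions given by elements of \<open>kQ\<close>\<close>

text \<open>The index set \<open>{0, \<dots>, t n}\<close>; it is empty if \<open>t n = - 1\<close>, i.e. if the \<open>n\<close>-th term is zero.\<close>

definition idx :: "(nat \<Rightarrow> int) \<Rightarrow> nat \<Rightarrow> nat set" where
  "idx t n = {i. int i \<le> t n}"

text \<open>The sum of the \<open>x i S\<close> over \<open>i \<in> A\<close>, for a right ideal \<open>S\<close>.\<close>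

definition sum_times :: "('r, 'm) ring_scheme \<Rightarrow> 'i set \<Rightarrow> ('i \<Rightarrow> 'r) \<Rightarrow> 'r set \<Rightarrow> 'r set" where
  "sum_times R A x S = {(\<Oplus>\<^bsub>R\<^esub>i\<in>A. x i \<otimes>\<^bsub>R\<^esub> s i) |s. s \<in> A \<rightarrow> S}"

text \<open>Directness of the sum of the right ideals \<open>x i R\<close>; it does not say that \<open>x i\<close> is regular.\<close>

definition direct_right_ideals :: "('r, 'm) ring_scheme \<Rightarrow> 'i set \<Rightarrow> ('i \<Rightarrow> 'r) \<Rightarrow> bool" where
  "direct_right_ideals R A x \<longleftrightarrow>
    (\<forall>s \<in> A \<rightarrow> carrier R. (\<Oplus>\<^bsub>R\<^esub>i\<in>A. x i \<otimes>\<^bsub>R\<^esub> s i) = \<zero>\<^bsub>R\<^esub> \<longrightarrow>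
       (\<forall>i\<in>A. x i \<otimes>\<^bsub>R\<^esub> s i = \<zero>\<^bsub>R\<^esub>))"

text \<open>
  For right ideals \<open>V \<subseteq> U\<close> of \<open>R\<close> with \<open>UI \<subseteq> V\<close>, the right \<open>R/I\<close>-module \<open>U/V\<close>.
\<close>

definition subquotient :: "('r, 'm) ring_scheme \<Rightarrow> 'r set \<Rightarrow> 'r set \<Rightarrow> ('r set, 'r set) module" where
  "subquotient R U V =
    \<lparr>carrier = {V +>\<^bsub>R\<^esub> x |x. x \<in> U}, monoid.mult = undefined, one = undefined,
     ring.zero = V,
     ring.add = set_add R,
     smult = (\<lambda>a m. \<Union>x\<in>m. \<Union>b\<in>a. V +>\<^bsub>R\<^esub> (x \<otimes>\<^bsub>R\<^esub> b))\<rparr>"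

context
  fixes Q :: "('v, 'a) pre_digraph"
    and I :: "(('v, 'a) qpath \<Rightarrow>\<^sub>0 'k::field) set"
    and t :: "nat \<Rightarrow> int"
    and f :: "nat \<Rightarrow> nat \<Rightarrow> (('v, 'a) qpath \<Rightarrow>\<^sub>0 'k)"
begin

definition res_top :: "nat \<Rightarrow> (('v, 'a) qpath \<Rightarrow>\<^sub>0 'k) set" where
  "res_top n = sum_times (path_algebra Q) (idx t n) (f n) (carrier (path_algebra Q))"

definition res_bot :: "nat \<Rightarrow> (('v, 'a) qpath \<Rightarrow>\<^sub>0 'k) set" where
  "res_bot n = sum_times (path_algebra Q) (idx t n) (f n) I"

definition res_module ::
    "nat \<Rightarrow> ((('v, 'a) qpath \<Rightarrow>\<^sub>0 'k) set, (('v, 'a) qpath \<Rightarrow>\<^sub>0 'k) set) module" where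
  "res_module n = subquotient (path_algebra Q) (res_top n) (res_bot n)"

definition res_class :: "nat \<Rightarrow> nat \<Rightarrow> (('v, 'a) qpath \<Rightarrow>\<^sub>0 'k) set" where
  "res_class n j = res_bot n +>\<^bsub>path_algebra Q\<^esub> f n j"

text \<open>The map \<open>F\<^sup>n \<rightarrow> F\<^sup>n\<^sup>-\<^sup>1\<close> induced by inclusion.\<close>

definition res_diff ::
    "nat \<Rightarrow> (('v, 'a) qpath \<Rightarrow>\<^sub>0 'k) set \<Rightarrow> (('v, 'a) qpath \<Rightarrow>\<^sub>0 'k) set" where
  "res_diff n =
    (\<lambda>m\<in>carrier (res_module n). \<Union>x\<in>m. res_bot (n - 1) +>\<^bsub>path_algebra Q\<^esub> x)"

text \<open>
  The augmentation is the projection \<open>top_proj\<close>, since \<open>F\<^sup>0 = R/I = \<Lambda>\<close> when the \<open>f\<^sup>0\<^sub>i\<close> are the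
  vertices.
\<close>

definition defines_minimal_resolution :: bool where
  "defines_minimal_resolution \<longleftrightarrow>
     (\<forall>n. \<forall>i\<in>idx t n. uniform Q (f n i) \<and> homogeneous_of_length n (f n i)) \<and>
     (\<forall>n. direct_right_ideals (path_algebra Q) (idx t n) (f n)) \<and>
     (\<forall>n. res_top (Suc n) \<subseteq> res_top n) \<and>
     res_top 0 = carrier (path_algebra Q) \<and>
     bij_betw (f 0) (idx t 0) (vertex_elt ` verts Q) \<and>
     bij_betw (f 1) (idx t 1) (arrow_elt Q ` arcs Q) \<and>
     Idl\<^bsub>path_algebra Q\<^esub> (f 2 ` idx t 2) = I \<and>
     (\<forall>A. A \<subset> f 2 ` idx t 2 \<longrightarrow> Idl\<^bsub>path_algebra Q\<^esub> A \<noteq> I) \<and>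
     minimal_projective_resolution (quiver_algebra Q I) (quiver_radical Q I) res_module res_diff
       (top_proj Q I) (top_module Q I)"

text \<open>The homomorphism \<open>F\<^sup>n \<rightarrow> \<Lambda>/\<rr>\<close> sending the class of \<open>f\<^sup>n\<^sub>j\<close> to \<open>\<delta>\<^sub>i\<^sub>j \<tt>(f\<^sup>n\<^sub>i)\<close>.\<close>

definition dual_hom ::
    "nat \<Rightarrow> nat \<Rightarrow> (('v, 'a) qpath \<Rightarrow>\<^sub>0 'k) set \<Rightarrow> (('v, 'a) qpath \<Rightarrow>\<^sub>0 'k) set set" where
  "dual_hom n i = (THE h. h \<in> right_hom (quiver_algebra Q I) (res_module n) (top_module Q I) \<and>
     (\<forall>j\<in>idx t n. h (res_class n j) =
        (if i = j
         then top_proj Q I (I +>\<^bsub>path_algebra Q\<^esub> vertex_elt (terminus Q (f n i)))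
         else \<zero>\<^bsub>top_module Q I\<^esub>)))"

definition Ext :: "nat \<Rightarrow> ('k, ((('v, 'a) qpath \<Rightarrow>\<^sub>0 'k) set
    \<Rightarrow> (('v, 'a) qpath \<Rightarrow>\<^sub>0 'k) set set) set) module" where
  "Ext n = ext_space (algebra_scalar Q I) (quiver_algebra Q I) res_module res_diff
     (top_module Q I) n"

definition dual_class :: "nat \<Rightarrow> nat
    \<Rightarrow> ((('v, 'a) qpath \<Rightarrow>\<^sub>0 'k) set \<Rightarrow> (('v, 'a) qpath \<Rightarrow>\<^sub>0 'k) set set) set" where
  "dual_class n i = ext_class (algebra_scalar Q I) (quiver_algebra Q I) res_module res_diff
     (top_module Q I) n (dual_hom n i)"

definition Ext_mult where
  "Ext_mult = yoneda_product (algebra_scalar Q I) (quiver_algebra Q I) res_module res_diff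
     (top_proj Q I) (top_module Q I)"

text \<open>
  The coefficients \<open>c p q n i r\<close> of the comultiplicative structure.  The equation determines them
  only where \<open>f\<^sup>r\<^sub>p f\<^sup>n\<^sup>-\<^sup>r\<^sub>q \<noteq> 0\<close>, that is, where the two factors are composable; the other
  coefficients are 0 by convention.
\<close>

definition comultiplicative_structure ::
    "(nat \<Rightarrow> nat \<Rightarrow> nat \<Rightarrow> nat \<Rightarrow> nat \<Rightarrow> 'k) \<Rightarrow> bool" where
  "comultiplicative_structure c \<longleftrightarrow>
    (\<forall>n. \<forall>i\<in>idx t n. \<forall>r\<le>n.
       f n i = (\<Oplus>\<^bsub>path_algebra Q\<^esub>p\<in>idx t r. \<Oplus>\<^bsub>path_algebra Q\<^esub>q\<in>idx t (n - r).
          pa_scale (c p q n i r) (f r p \<otimes>\<^bsub>path_algebra Q\<^esub> f (n - r) q)) \<and>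
       (\<forall>p\<in>idx t r. \<forall>q\<in>idx t (n - r).
          f r p \<otimes>\<^bsub>path_algebra Q\<^esub> f (n - r) q = \<zero>\<^bsub>path_algebra Q\<^esub> \<longrightarrow> c p q n i r = 0))"

end

end

theory Submission
  imports Defs
begin

text \<open>
  Since the sum of the \<open>f\<^sup>n\<^sub>j R\<close> is direct and \<open>f\<^sup>n\<^sub>j\<close> is homogeneous, each \<open>y\<close> in it has unique
  components \<open>y\<^sub>j = \<tt>(f\<^sup>n\<^sub>j) y\<^sub>j\<close> with \<open>y = \<Sum>j. f\<^sup>n\<^sub>j y\<^sub>j\<close>, and the dual homomorphism of
  \<open>f\<^sup>n\<^sub>j\<close> sends the class of \<open>y\<close> to the class of \<open>y\<^sub>j\<close>.  All differentials vanish on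
  homomorphisms to \<open>\<Lambda>/\<rr>\<close>, so Ext is the space of these homomorphisms.  By the comultiplicative
  structure, \<open>y \<mapsto> y\<^sub>j\<close> maps the sum of the \<open>f\<^sup>n\<^sup>+\<^sup>r\<^sub>l R\<close> to the sum of the \<open>f\<^sup>r\<^sub>i R\<close>, and as the
  differentials are induced by inclusions this is a lifting of the dual homomorphism.  The
  component of \<open>f\<^sup>m\<^sup>+\<^sup>n\<^sub>l\<close> at \<open>f\<^sup>n\<^sub>j\<close>, and then at \<open>f\<^sup>m\<^sub>i\<close>, is the coefficient \<open>c j i (m + n) l n\<close>
  times a vertex.  Any other lifting has the same leading terms, because \<open>I\<close> lies in path
  lengths at least 2, and a homomorphism to \<open>\<Lambda>/\<rr>\<close> only sees these.
\<close>

section \<open>Products and path length\<close>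

text \<open>The length filtration of kQ, used in place of powers of the arrow ideal: lengths add
  under products (\<open>L_mult\<close>), and the term for \<open>d = 1\<close> is the arrow ideal
  itself (\<open>arrow_ideal_eq\<close>).\<close>

definition length_ge :: "('v, 'a) pre_digraph \<Rightarrow> nat \<Rightarrow> (('v, 'a) qpath \<Rightarrow>\<^sub>0 'k::field) set" where
  "length_ge Q d = {x \<in> carrier (path_algebra Q). \<forall>p\<in>Poly_Mapping.keys x. d \<le> length (snd p)}"

lemma path_algebra_simps:
  "carrier (path_algebra Q) = {x. Poly_Mapping.keys x \<subseteq> quiver_paths Q}"
  "\<zero>\<^bsub>path_algebra Q\<^esub> = 0"
  "x \<oplus>\<^bsub>path_algebra Q\<^esub> y = x + y"
  by (simp_all add: path_algebra_def)

text \<open>Pairs outside the supports contribute 0. This freedom permits one-path index sets for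
  vertices and arrows, and keeps the index set fixed under scaling by a constant that may be
  0.\<close>

lemma path_algebra_mult_superset:
  fixes x y :: "('v, 'a) qpath \<Rightarrow>\<^sub>0 'k::field"
  assumes "finite A" "finite B" "Poly_Mapping.keys x \<subseteq> A" "Poly_Mapping.keys y \<subseteq> B"
  shows "x \<otimes>\<^bsub>path_algebra Q\<^esub> y = (\<Sum>p\<in>A. \<Sum>q\<in>B. if path_end Q p = fst q
        then Poly_Mapping.single (fst p, snd p @ snd q)
               (Poly_Mapping.lookup x p * Poly_Mapping.lookup y q) else 0)"
proof -
  have inner: "(\<Sum>q\<in>Poly_Mapping.keys y. if path_end Q p = fst q
        then Poly_Mapping.single (fst p, snd p @ snd q)
               (Poly_Mapping.lookup x p * Poly_Mapping.lookup y q) else 0) =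
       (\<Sum>q\<in>B. if path_end Q p = fst q
        then Poly_Mapping.single (fst p, snd p @ snd q)
               (Poly_Mapping.lookup x p * Poly_Mapping.lookup y q) else 0)" for p
    by (rule sum.mono_neutral_left) (use assms in \<open>auto simp: in_keys_iff\<close>)
  show ?thesis
    unfolding path_algebra_def monoid.simps ring.simps inner
    by (rule sum.mono_neutral_left)
       (use assms in \<open>auto simp: in_keys_iff intro!: sum.neutral\<close>)
qed

lemma path_algebra_mult:
  "x \<otimes>\<^bsub>path_algebra Q\<^esub> y = (\<Sum>p\<in>Poly_Mapping.keys x. \<Sum>q\<in>Poly_Mapping.keys y.
        if path_end Q p = fst q
        then Poly_Mapping.single (fst p, snd p @ snd q)
               (Poly_Mapping.lookup x p * Poly_Mapping.lookup y q) else 0)"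
  by (rule path_algebra_mult_superset) auto

lemma keys_path_algebra_mult:
  assumes "w \<in> Poly_Mapping.keys (x \<otimes>\<^bsub>path_algebra Q\<^esub> y)"
  obtains p q where "p \<in> Poly_Mapping.keys x" "q \<in> Poly_Mapping.keys y"
    "path_end Q p = fst q" "w = (fst p, snd p @ snd q)"
proof -
  have "Poly_Mapping.lookup (x \<otimes>\<^bsub>path_algebra Q\<^esub> y) w \<noteq> 0"
    using assms by (simp add: in_keys_iff)
  then obtain p q where pq: "p \<in> Poly_Mapping.keys x" "q \<in> Poly_Mapping.keys y"
    "Poly_Mapping.lookup (if path_end Q p = fst q
        then Poly_Mapping.single (fst p, snd p @ snd q)
               (Poly_Mapping.lookup x p * Poly_Mapping.lookup y q) else 0) w \<noteq> 0"
    unfolding path_algebra_mult lookup_sum by (meson sum.not_neutral_contains_not_neutral)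
  with that show thesis
    by (auto simp: lookup_single when_def split: if_splits)
qed

section \<open>Multiplication by vertices and by scalars, on coefficients\<close>

lemma path_end_Nil [simp]: "path_end Q (v, []) = v"
  by (simp add: path_end_def pre_digraph.awalk_verts.simps)

lemma lookup_vertex_elt: "Poly_Mapping.lookup (vertex_elt v) p = (if p = (v, []) then 1 else 0)"
  by (auto simp: vertex_elt_def lookup_single when_def)

lemma lookup_mult_vertex_elt:
  "Poly_Mapping.lookup (x \<otimes>\<^bsub>path_algebra Q\<^esub> vertex_elt v) p =
     (if path_end Q p = v then Poly_Mapping.lookup x p else 0)"
proof -
  have "x \<otimes>\<^bsub>path_algebra Q\<^esub> vertex_elt v =
      (\<Sum>q\<in>Poly_Mapping.keys x. if path_end Q q = v then Poly_Mapping.single q (Poly_Mapping.lookup x q) else 0)"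
    by (subst path_algebra_mult_superset[of "Poly_Mapping.keys x" "{(v, [])}"])
       (auto simp: vertex_elt_def intro!: sum.cong)
  also have "Poly_Mapping.lookup \<dots> p =
      (\<Sum>q\<in>Poly_Mapping.keys x. if q = p then if path_end Q p = v then Poly_Mapping.lookup x p else 0 else 0)"
    unfolding lookup_sum by (rule sum.cong) (auto simp: lookup_single when_def)
  also have "\<dots> = (if path_end Q p = v then Poly_Mapping.lookup x p else 0)"
    by (subst sum.delta) (auto simp: in_keys_iff)
  finally show ?thesis .
qed

lemma lookup_vertex_elt_mult:
  "Poly_Mapping.lookup (vertex_elt v \<otimes>\<^bsub>path_algebra Q\<^esub> x) p =
     (if fst p = v then Poly_Mapping.lookup x p else 0)"
proof -
  have "vertex_elt v \<otimes>\<^bsub>path_algebra Q\<^esub> x =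
      (\<Sum>q\<in>Poly_Mapping.keys x. if fst q = v then Poly_Mapping.single q (Poly_Mapping.lookup x q) else 0)"
    by (subst path_algebra_mult_superset[of "{(v, [])}" "Poly_Mapping.keys x"])
       (auto simp: vertex_elt_def intro!: sum.cong)
  also have "Poly_Mapping.lookup \<dots> p =
      (\<Sum>q\<in>Poly_Mapping.keys x. if q = p then if fst p = v then Poly_Mapping.lookup x p else 0 else 0)"
    unfolding lookup_sum by (rule sum.cong) (auto simp: lookup_single when_def)
  also have "\<dots> = (if fst p = v then Poly_Mapping.lookup x p else 0)"
    by (subst sum.delta) (auto simp: in_keys_iff)
  finally show ?thesis .
qed

lemma lookup_pa_scale [simp]: "Poly_Mapping.lookup (pa_scale c x) p = c * Poly_Mapping.lookup x p"
  by (simp add: pa_scale_def Poly_Mapping.map.rep_eq when_def)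

lemma keys_pa_scale: "Poly_Mapping.keys (pa_scale c x) \<subseteq> Poly_Mapping.keys x"
  by (auto simp: in_keys_iff)

lemma pa_scale_zero [simp]: "pa_scale 0 x = 0" "pa_scale c 0 = 0"
  by (auto intro: poly_mapping_eqI)

lemma single_scale: "Poly_Mapping.single p (c * a) = pa_scale c (Poly_Mapping.single p a)"
  by (auto intro!: poly_mapping_eqI simp: lookup_single when_def)

lemma pa_scale_add: "pa_scale c (x + y) = pa_scale c x + pa_scale c y"
  by (auto intro!: poly_mapping_eqI simp: lookup_add algebra_simps)

lemma pa_scale_sum: "pa_scale c (sum g A) = (\<Sum>i\<in>A. pa_scale c (g i))"
  by (auto intro!: poly_mapping_eqI simp: lookup_sum sum_distrib_left)

lemma pa_scale_mult_left:
  "pa_scale c x \<otimes>\<^bsub>path_algebra Q\<^esub> y = pa_scale c (x \<otimes>\<^bsub>path_algebra Q\<^esub> y)"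
proof -
  have "pa_scale c x \<otimes>\<^bsub>path_algebra Q\<^esub> y = (\<Sum>p\<in>Poly_Mapping.keys x. \<Sum>q\<in>Poly_Mapping.keys y.
        if path_end Q p = fst q then Poly_Mapping.single (fst p, snd p @ snd q)
               (Poly_Mapping.lookup (pa_scale c x) p * Poly_Mapping.lookup y q) else 0)"
    by (rule path_algebra_mult_superset) (auto simp: keys_pa_scale)
  then show ?thesis
    by (simp add: path_algebra_mult pa_scale_sum single_scale mult.assoc if_distrib cong: if_cong)
qed

lemma pa_scale_mult_right:
  "x \<otimes>\<^bsub>path_algebra Q\<^esub> pa_scale c y = pa_scale c (x \<otimes>\<^bsub>path_algebra Q\<^esub> y)"
proof -
  have "x \<otimes>\<^bsub>path_algebra Q\<^esub> pa_scale c y = (\<Sum>p\<in>Poly_Mapping.keys x. \<Sum>q\<in>Poly_Mapping.keys y.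
        if path_end Q p = fst q then Poly_Mapping.single (fst p, snd p @ snd q)
               (Poly_Mapping.lookup x p * Poly_Mapping.lookup (pa_scale c y) q) else 0)"
    by (rule path_algebra_mult_superset) (auto simp: keys_pa_scale)
  then show ?thesis
    by (simp add: path_algebra_mult pa_scale_sum single_scale mult.left_commute if_distrib cong: if_cong)
qed

lemma pa_scale_closed:
  "x \<in> carrier (path_algebra Q) \<Longrightarrow> pa_scale c x \<in> carrier (path_algebra Q)"
  using keys_pa_scale[of c x] by (auto simp: path_algebra_simps)

section \<open>The length filtration and cancellation of a homogeneous left factor\<close>

lemma length_ge_closed:
  shows "0 \<in> length_ge Q d"
    and "\<lbrakk>x \<in> length_ge Q d; y \<in> length_ge Q d\<rbrakk> \<Longrightarrow> x + y \<in> length_ge Q d"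
    and "\<lbrakk>x \<in> length_ge Q d; y \<in> length_ge Q d\<rbrakk> \<Longrightarrow> x - y \<in> length_ge Q d"
    and "x \<in> length_ge Q d \<Longrightarrow> pa_scale c x \<in> length_ge Q d"
  using keys_add[of x y] keys_diff[of x y] keys_pa_scale[of c x]
  by (auto simp: length_ge_def path_algebra_simps)

lemma length_ge_carrier: "x \<in> length_ge Q d \<Longrightarrow> x \<in> carrier (path_algebra Q)"
  by (simp add: length_ge_def)

lemma length_ge_0: "length_ge Q 0 = carrier (path_algebra Q)"
  by (simp add: length_ge_def)

lemma length_ge_mono: "d \<le> d' \<Longrightarrow> length_ge Q d' \<subseteq> length_ge Q d"
  by (auto simp: length_ge_def)

lemma length_ge_sum: "(\<And>i. i \<in> A \<Longrightarrow> g i \<in> length_ge Q d) \<Longrightarrow> sum g A \<in> length_ge Q d"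
  by (induction A rule: infinite_finite_induct) (auto simp: length_ge_closed)

text \<open>Once the length of the first factor is fixed, a path splits in at most one way. So for
  \<open>p\<close> in the support of \<open>x\<close>, which must end at \<open>v\<close>, and
  \<open>q\<close> starting at \<open>v\<close>, the coefficient of the product at the concatenated
  path is the coefficient of \<open>x\<close> at \<open>p\<close> times that of \<open>s\<close> at
  \<open>q\<close>.\<close>

lemma mult_eq_0_homogeneous:
  fixes x s :: "('v, 'a) qpath \<Rightarrow>\<^sub>0 'k::field"
  assumes x: "homogeneous_of_length n x" "x \<noteq> 0" "x \<otimes>\<^bsub>path_algebra Q\<^esub> vertex_elt v = x"
    and xs: "x \<otimes>\<^bsub>path_algebra Q\<^esub> s = 0"
  shows "vertex_elt v \<otimes>\<^bsub>path_algebra Q\<^esub> s = 0"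
proof (rule poly_mapping_eqI)
  fix q
  obtain p where p: "p \<in> Poly_Mapping.keys x" using x(2) by (metis all_not_in_conv keys_eq_empty)
  with x(3) have pe: "path_end Q p = v"
    by (metis in_keys_iff lookup_mult_vertex_elt)
  have lenp: "length (snd p) = n" using p x(1) by (auto simp: homogeneous_of_length_def)
  have "Poly_Mapping.lookup s q = 0" if q: "fst q = v"
  proof -
    have eq: "(p', q') = (p, q)" if "p' \<in> Poly_Mapping.keys x" "path_end Q p' = fst q'"
      "(fst p', snd p' @ snd q') = (fst p, snd p @ snd q)" for p' q'
    proof -
      have "length (snd p') = length (snd p)"
        using that(1) lenp x(1) by (simp add: homogeneous_of_length_def)
      then have p': "p' = p" and "snd q' = snd q"
        using that(3) by (cases p'; cases p; simp)+
      moreover have "fst q' = fst q"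
        using that(2) pe q p' by simp
      ultimately show ?thesis by (simp add: prod_eq_iff)
    qed
    have summand: "Poly_Mapping.lookup (if path_end Q p' = fst q'
        then Poly_Mapping.single (fst p', snd p' @ snd q')
               (Poly_Mapping.lookup x p' * Poly_Mapping.lookup s q') else 0) (fst p, snd p @ snd q) =
        (if q' = q then if p' = p then Poly_Mapping.lookup x p * Poly_Mapping.lookup s q else 0 else 0)"
      if "p' \<in> Poly_Mapping.keys x" for p' q'
    proof (cases "p' = p \<and> q' = q")
      case True
      with pe q show ?thesis by simp
    next
      case False
      then have "\<not> (path_end Q p' = fst q' \<and> (fst p', snd p' @ snd q') = (fst p, snd p @ snd q))"
        using eq that by blast
      with False show ?thesis by (auto simp: lookup_single when_def)
    qed
    have "0 = Poly_Mapping.lookup (x \<otimes>\<^bsub>path_algebra Q\<^esub> s) (fst p, snd p @ snd q)"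
      by (simp add: xs)
    \<comment> \<open>\<open>q\<close> is put into the index set by hand, since it need not lie in
      the support of \<open>s\<close>.\<close>
    also have "\<dots> = (\<Sum>p'\<in>Poly_Mapping.keys x. \<Sum>q'\<in>insert q (Poly_Mapping.keys s).
        if q' = q then if p' = p then Poly_Mapping.lookup x p * Poly_Mapping.lookup s q else 0 else 0)"
      unfolding path_algebra_mult_superset[of "Poly_Mapping.keys x" "insert q (Poly_Mapping.keys s)" x s Q,
          OF finite_keys finite.insertI[OF finite_keys] subset_refl subset_insertI] lookup_sum
      using summand by (intro sum.cong refl)
    also have "\<dots> = (\<Sum>p'\<in>Poly_Mapping.keys x. if p' = p then Poly_Mapping.lookup x p * Poly_Mapping.lookup s q else 0)"
      by (subst sum.delta) auto
    also have "\<dots> = Poly_Mapping.lookup x p * Poly_Mapping.lookup s q"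
      using p by (subst sum.delta) auto
    finally show ?thesis using p by (simp add: in_keys_iff)
  qed
  then show "Poly_Mapping.lookup (vertex_elt v \<otimes>\<^bsub>path_algebra Q\<^esub> s) q = Poly_Mapping.lookup 0 q"
    by (simp add: lookup_vertex_elt_mult)
qed

lemma vertex_elt_mult:
  "vertex_elt u \<otimes>\<^bsub>path_algebra Q\<^esub> vertex_elt v = (if u = v then vertex_elt v else 0)"
  by (rule poly_mapping_eqI)
     (auto simp: lookup_vertex_elt_mult, auto simp: vertex_elt_def lookup_single when_def)

lemma vertex_elt_closed: "v \<in> verts Q \<Longrightarrow> vertex_elt v \<in> carrier (path_algebra Q)"
  by (auto simp: vertex_elt_def path_algebra_simps quiver_paths_def pre_digraph.awalk_def
      pre_digraph.cas.simps)

section \<open>The quotients \<open>\<Lambda>\<close> and \<open>\<Lambda>/\<rr>\<close>\<close>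

text \<open>Stated for a set with 0 and closed under differences, so that it serves the ideal
  \<open>I\<close>, the length filtration and the right ideals \<open>res_bot\<close> alike.\<close>

lemma coset_eq_iff:
  fixes S :: "'g::ab_group_add set"
  assumes "0 \<in> S" "\<And>x y. \<lbrakk>x \<in> S; y \<in> S\<rbrakk> \<Longrightarrow> x - y \<in> S"
  shows "{z. z - x \<in> S} = {z. z - y \<in> S} \<longleftrightarrow> x - y \<in> S"
proof
  assume eq: "{z. z - x \<in> S} = {z. z - y \<in> S}"
  have "x \<in> {z. z - x \<in> S}" using assms(1) by simp
  then have "x \<in> {z. z - y \<in> S}" by (simp only: eq)
  then show "x - y \<in> S" by simp
next
  assume xy: "x - y \<in> S"
  then have yx: "y - x \<in> S" using assms(2)[OF assms(1) xy] by simp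
  have "z - y \<in> S" if "z - x \<in> S" for z using assms(2)[OF that yx] by simp
  moreover have "z - x \<in> S" if "z - y \<in> S" for z using assms(2)[OF that xy] by simp
  ultimately show "{z. z - x \<in> S} = {z. z - y \<in> S}" by auto
qed

section \<open>The ring kQ, the ideal \<open>I\<close> and the length filtration\<close>

locale quiver_ideal =
  fixes Q :: "('v, 'a) pre_digraph"
    and I :: "(('v, 'a) qpath \<Rightarrow>\<^sub>0 'k::field) set"
  assumes fin_digraph_Q: "fin_digraph Q"
    and ideal_I: "ideal I (path_algebra Q)"
    and I_subset_square: "I \<subseteq> arrow_ideal Q \<cdot>\<^bsub>path_algebra Q\<^esub> arrow_ideal Q"
begin

sublocale R: ring "path_algebra Q :: (('v, 'a) qpath \<Rightarrow>\<^sub>0 'k) ring"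
  using ideal_I by (rule ideal.axioms(2))

sublocale I: ideal I "path_algebra Q"
  by (rule ideal_I)

abbreviation K :: "(('v, 'a) qpath \<Rightarrow>\<^sub>0 'k) set" where "K \<equiv> carrier (path_algebra Q)"

abbreviation mul (infixl "\<star>" 70) where "x \<star> y \<equiv> x \<otimes>\<^bsub>path_algebra Q\<^esub> y"

abbreviation L :: "nat \<Rightarrow> (('v, 'a) qpath \<Rightarrow>\<^sub>0 'k) set" where "L \<equiv> length_ge Q"

abbreviation e :: "'v \<Rightarrow> ('v, 'a) qpath \<Rightarrow>\<^sub>0 'k" where "e \<equiv> vertex_elt"

abbreviation one_K :: "('v, 'a) qpath \<Rightarrow>\<^sub>0 'k" where "one_K \<equiv> \<one>\<^bsub>path_algebra Q\<^esub>"

lemma K_closed [simp, intro]: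
  shows "0 \<in> K"
    and "\<lbrakk>x \<in> K; y \<in> K\<rbrakk> \<Longrightarrow> x + y \<in> K"
    and "\<lbrakk>x \<in> K; y \<in> K\<rbrakk> \<Longrightarrow> x - y \<in> K"
    and "\<lbrakk>x \<in> K; y \<in> K\<rbrakk> \<Longrightarrow> x \<star> y \<in> K"
    and "x \<in> K \<Longrightarrow> pa_scale c x \<in> K"
  using length_ge_closed(1)[of Q 0] length_ge_closed(2,3)[of x Q 0 y] R.m_closed pa_scale_closed by (auto simp: length_ge_0)

lemma K_sum [intro]: "(\<And>i. i \<in> A \<Longrightarrow> g i \<in> K) \<Longrightarrow> sum g A \<in> K"
  using length_ge_sum[of A g Q 0] by (simp add: length_ge_0)

lemma uminus_eq: "x \<in> K \<Longrightarrow> \<ominus>\<^bsub>path_algebra Q\<^esub> x = - x"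
  using K_closed(3)[OF K_closed(1), of x]
  by (intro R.minus_equality) (auto simp: path_algebra_simps)

lemma I_closed:
  shows "0 \<in> I"
    and "x \<in> I \<Longrightarrow> x \<in> K"
    and "\<lbrakk>x \<in> I; y \<in> I\<rbrakk> \<Longrightarrow> x + y \<in> I"
    and "\<lbrakk>x \<in> I; y \<in> I\<rbrakk> \<Longrightarrow> x - y \<in> I"
    and "\<lbrakk>x \<in> I; a \<in> K\<rbrakk> \<Longrightarrow> x \<star> a \<in> I"
    and "\<lbrakk>x \<in> I; a \<in> K\<rbrakk> \<Longrightarrow> a \<star> x \<in> I"
proof -
  show "0 \<in> I" using I.zero_closed by (simp add: path_algebra_simps)
  show K: "x \<in> K" if "x \<in> I" for x
    using I.a_subset that by auto
  show add: "x + y \<in> I" if "x \<in> I" "y \<in> I" for x y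
    using I.a_closed[OF that] by (simp add: path_algebra_simps)
  show "x \<star> a \<in> I" "a \<star> x \<in> I" if "x \<in> I" "a \<in> K" for x a
    using that I.I_r_closed I.I_l_closed by auto
  show "x - y \<in> I" if xy: "x \<in> I" "y \<in> I"
  proof -
    show ?thesis using add[OF xy(1) I.a_inv_closed[OF xy(2)]] K[OF xy(2)] by (simp add: uminus_eq)
  qed
qed

lemma distr:
  assumes "x \<in> K" "y \<in> K" "z \<in> K"
  shows "(x + y) \<star> z = x \<star> z + y \<star> z" "z \<star> (x + y) = z \<star> x + z \<star> y"
    "(x - y) \<star> z = x \<star> z - y \<star> z" "z \<star> (x - y) = z \<star> x - z \<star> y"
proof -
  have *: "(x + y) \<star> z = x \<star> z + y \<star> z" "z \<star> (x + y) = z \<star> x + z \<star> y" if "x \<in> K" "y \<in> K" for x y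
    using R.l_distr[OF that assms(3)] R.r_distr[OF that assms(3)] by (simp_all only: path_algebra_simps)
  show "(x + y) \<star> z = x \<star> z + y \<star> z" "z \<star> (x + y) = z \<star> x + z \<star> y"
    using * assms by auto
  show "(x - y) \<star> z = x \<star> z - y \<star> z" "z \<star> (x - y) = z \<star> x - z \<star> y"
    using *[of "x - y" y] assms by (metis K_closed(3) add_diff_cancel diff_add_cancel)+
qed

lemma mul_0 [simp]: "x \<star> 0 = 0" "0 \<star> x = 0"
  by (simp_all add: path_algebra_mult)

lemma sum_distr:
  assumes "\<And>i. i \<in> A \<Longrightarrow> g i \<in> K" "z \<in> K"
  shows "sum g A \<star> z = (\<Sum>i\<in>A. g i \<star> z)" "z \<star> sum g A = (\<Sum>i\<in>A. z \<star> g i)"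
  using assms by (induction A rule: infinite_finite_induct) (auto simp: distr K_sum)

lemma finsum_eq_sum:
  assumes "finite A" "\<And>i. i \<in> A \<Longrightarrow> g i \<in> K"
  shows "finsum (path_algebra Q) g A = sum g A"
  using assms
proof (induction A rule: finite_induct)
  case empty
  then show ?case by (simp add: path_algebra_simps)
next
  case (insert x A)
  then have "finsum (path_algebra Q) g (insert x A) = g x \<oplus>\<^bsub>path_algebra Q\<^esub> finsum (path_algebra Q) g A"
    by (intro R.finsum_insert) auto
  with insert show ?case by (simp add: path_algebra_simps)
qed

lemma mul_pa_scale_one: "x \<in> K \<Longrightarrow> x \<star> pa_scale c one_K = pa_scale c x"
  by (simp add: pa_scale_mult_right)

lemma L_mult:
  assumes "x \<in> L a" "y \<in> L b"
  shows "x \<star> y \<in> L (a + b)"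
  using assms
  by (force simp: length_ge_def elim!: keys_path_algebra_mult intro: add_mono)

lemma L_closed:
  shows "\<lbrakk>x \<in> L a; y \<in> K\<rbrakk> \<Longrightarrow> x \<star> y \<in> L a" "\<lbrakk>x \<in> L a; y \<in> K\<rbrakk> \<Longrightarrow> y \<star> x \<in> L a"
  using L_mult[of x a y 0] L_mult[of y 0 x a] by (auto simp: length_ge_0)

lemma L_in_K: "x \<in> L a \<Longrightarrow> x \<in> K"
  by (rule length_ge_carrier)

lemma ideal_L: "ideal (L a) (path_algebra Q)"
proof (rule idealI)
  show "subgroup (L a) (add_monoid (path_algebra Q))"
  proof (rule R.add.subgroupI)
    show "L a \<subseteq> carrier (path_algebra Q)" by (auto simp: L_in_K)
    show "L a \<noteq> {}" using length_ge_closed(1) by auto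
    show "\<ominus>\<^bsub>path_algebra Q\<^esub> x \<in> L a" if "x \<in> L a" for x
      using length_ge_closed(3)[OF length_ge_closed(1) that] that by (simp add: uminus_eq L_in_K)
    show "x \<oplus>\<^bsub>path_algebra Q\<^esub> y \<in> L a" if "x \<in> L a" "y \<in> L a" for x y
      using length_ge_closed(2)[OF that] by (simp add: path_algebra_simps)
  qed
qed (auto simp: R.ring_axioms L_closed)

lemma arrow_elt_in_L: "arrow_elt Q ` arcs Q \<subseteq> L 1"
proof -
  interpret fin_digraph Q by (rule fin_digraph_Q)
  show ?thesis
    by (auto simp: arrow_elt_def length_ge_def path_algebra_simps quiver_paths_def path_end_def
        pre_digraph.awalk_def pre_digraph.cas.simps pre_digraph.awalk_verts.simps)
qed

abbreviation J :: "(('v, 'a) qpath \<Rightarrow>\<^sub>0 'k) set" where "J \<equiv> arrow_ideal Q"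

text \<open>\<open>L 1\<close> is an ideal containing the arrows, which gives one inclusion.
  Conversely, a path of positive length is its first arrow times the remaining path, and every
  element of \<open>L 1\<close> is a sum of multiples of such paths.\<close>

lemma arrow_ideal_eq: "J = L 1"
proof
  interpret D: fin_digraph Q by (rule fin_digraph_Q)
  show "J \<subseteq> L 1"
    unfolding arrow_ideal_def by (rule R.genideal_minimal[OF ideal_L arrow_elt_in_L])
  have arr: "arrow_elt Q ` arcs Q \<subseteq> K" using arrow_elt_in_L L_in_K by blast
  interpret J: ideal J "path_algebra Q"
    unfolding arrow_ideal_def using arr by (rule R.genideal_ideal)
  have single: "Poly_Mapping.single p c \<in> J"
    if p: "p \<in> quiver_paths Q" "1 \<le> length (snd p)" for p and c :: 'k
  proof -
    obtain v a as where pv: "p = (v, a # as)" using p(2) by (cases p; cases "snd p") auto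
    have a: "a \<in> arcs Q" "v = tail Q a" "(head Q a, as) \<in> quiver_paths Q"
      using p(1) by (auto simp: pv quiver_paths_def path_end_def D.awalk_Cons_iff)
    have "arrow_elt Q a \<star> Poly_Mapping.single (head Q a, as) c = Poly_Mapping.single p c"
      by (subst path_algebra_mult_superset[of "{(tail Q a, [a])}" "{(head Q a, as)}"])
         (auto simp: arrow_elt_def pv a path_end_def)
    moreover have "arrow_elt Q a \<in> J"
      using R.genideal_self[OF arr] a(1) by (auto simp: arrow_ideal_def)
    ultimately show ?thesis
      using J.I_r_closed[of "arrow_elt Q a" "Poly_Mapping.single (head Q a, as) c"] a(3)
      by (auto simp: path_algebra_simps)
  qed
  show "L 1 \<subseteq> J"
  proof
    fix x assume x: "x \<in> L 1"
    have "(\<Sum>p\<in>A. Poly_Mapping.single p (Poly_Mapping.lookup x p)) \<in> J"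
      if "finite A" "A \<subseteq> Poly_Mapping.keys x" for A
      using that
    proof (induction A rule: finite_induct)
      case empty
      then show ?case using J.zero_closed by (simp add: path_algebra_simps)
    next
      case (insert p A)
      then show ?case
        using x J.a_closed[OF single[of p "Poly_Mapping.lookup x p"]]
        by (auto simp: length_ge_def path_algebra_simps)
    qed
    moreover have "(\<Sum>p\<in>Poly_Mapping.keys x. Poly_Mapping.single p (Poly_Mapping.lookup x p)) = x"
      by (rule poly_mapping_eqI)
         (simp add: lookup_sum lookup_single when_def sum.delta in_keys_iff)
    ultimately show "x \<in> J"
      by (metis finite_keys order_refl)
  qed
qed

text \<open>Elements of the product ideal are built from products of two elements of
  \<open>L 1\<close> by addition, and lengths add. This gap of two is what later makes all liftings
  agree in their leading terms.\<close>

lemma I_subset_L: "I \<subseteq> L 2"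
proof
  fix x assume "x \<in> I"
  then have "x \<in> L 1 \<cdot>\<^bsub>path_algebra Q\<^esub> L 1" using I_subset_square by (auto simp: arrow_ideal_eq)
  then show "x \<in> L 2"
    by induction (use L_mult[of _ 1 _ 1] in \<open>auto simp: path_algebra_simps(2,3) numeral_2_eq_2 intro: length_ge_closed\<close>)
qed

text \<open>Differences are taken among all finitely supported functions, so that
  \<open>coset_eq_iff\<close> compares cosets without tracking membership in the carrier.\<close>

lemma coset_altdef: "S +>\<^bsub>path_algebra Q\<^esub> x = {z. z - x \<in> S}"
proof -
  have "z \<in> (\<Union>h\<in>S. {h + x}) \<longleftrightarrow> z - x \<in> S" for z
  proof
    assume "z - x \<in> S"
    then show "z \<in> (\<Union>h\<in>S. {h + x})" by (intro UN_I[of "z - x"]) simp_all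
  qed auto
  then show ?thesis by (simp add: a_r_coset_def r_coset_def path_algebra_simps set_eq_iff)
qed

lemma set_add_coset:
  assumes "0 \<in> S" "\<And>x y. \<lbrakk>x \<in> S; y \<in> S\<rbrakk> \<Longrightarrow> x + y \<in> S"
  shows "set_add (path_algebra Q) {z. z - x \<in> S} {z. z - y \<in> S} = {z. z - (x + y) \<in> S}"
proof -
  have "z \<in> (\<Union>a\<in>{z. z - x \<in> S}. \<Union>b\<in>{z. z - y \<in> S}. {a + b}) \<longleftrightarrow> z - (x + y) \<in> S" for z
  proof
    assume "z \<in> (\<Union>a\<in>{z. z - x \<in> S}. \<Union>b\<in>{z. z - y \<in> S}. {a + b})"
    then obtain a b where "a - x \<in> S" "b - y \<in> S" "z = a + b" by auto
    then show "z - (x + y) \<in> S" using assms(2)[of "a - x" "b - y"] by (simp add: algebra_simps)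
  next
    assume "z - (x + y) \<in> S"
    then have "z - y \<in> {z. z - x \<in> S}" "y \<in> {z. z - y \<in> S}" "z = (z - y) + y"
      using assms(1) by (simp_all add: algebra_simps)
    then show "z \<in> (\<Union>a\<in>{z. z - x \<in> S}. \<Union>b\<in>{z. z - y \<in> S}. {a + b})" by blast
  qed
  then show ?thesis by (auto simp: set_add_def set_mult_def path_algebra_simps)
qed

section \<open>Residue classes in \<Lambda>, in its top, and in subquotients of kQ\<close>

abbreviation \<Lambda> where "\<Lambda> \<equiv> quiver_algebra Q I"

text \<open>The residue class map from kQ to \<Lambda>.\<close>

definition q :: "(('v, 'a) qpath \<Rightarrow>\<^sub>0 'k) \<Rightarrow> (('v, 'a) qpath \<Rightarrow>\<^sub>0 'k) set" where
  "q x = {z. z - x \<in> I}"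

lemma q_eq: "I +>\<^bsub>path_algebra Q\<^esub> x = q x"
  by (simp add: q_def coset_altdef)

lemma q_eq_iff: "q x = q y \<longleftrightarrow> x - y \<in> I"
  unfolding q_def by (rule coset_eq_iff) (auto intro: I_closed)

lemma q_zero: "q 0 = I"
  by (simp add: q_def)

lemma quiver_algebra_simps:
  "carrier \<Lambda> = q ` K" "\<zero>\<^bsub>\<Lambda>\<^esub> = q 0" "\<one>\<^bsub>\<Lambda>\<^esub> = q one_K"
  "q x \<oplus>\<^bsub>\<Lambda>\<^esub> q y = q (x + y)"
  "\<lbrakk>x \<in> K; y \<in> K\<rbrakk> \<Longrightarrow> q x \<otimes>\<^bsub>\<Lambda>\<^esub> q y = q (x \<star> y)"
  using I.rcoset_mult_add[of x y] set_add_coset[of I x y]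
  by (auto simp: quiver_algebra_def FactRing_def A_RCOSETS_def' q_eq q_zero q_def[symmetric] I_closed)

lemma mem_coset_q:
  assumes "x \<in> K" "z \<in> q x"
  shows "z \<in> K" "q z = q x"
proof -
  show "q z = q x" using assms by (simp add: q_eq_iff) (simp add: q_def)
  have "z - x \<in> K" using assms by (auto simp: q_def intro: I_closed)
  then show "z \<in> K" using K_closed(2)[OF _ assms(1), of "z - x"] by simp
qed

lemma self_mem_q: "x \<in> q x"
  by (simp add: q_def I_closed)

text \<open>The projection of kQ to the top of \<Lambda>. Its values are sets of residue classes
  because an element of the iterated quotient is a coset of cosets.\<close>

definition rho :: "(('v, 'a) qpath \<Rightarrow>\<^sub>0 'k) \<Rightarrow> (('v, 'a) qpath \<Rightarrow>\<^sub>0 'k) set set" where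
  "rho x = q ` {z. z - x \<in> L 1}"

lemma I_subset_L1: "I \<subseteq> L 1"
  using I_subset_L length_ge_mono[of 1 2 Q] by auto

text \<open>As \<open>I\<close> lies in \<open>L 1\<close>, altering a representative by
  \<open>I\<close> does not change its coset of \<open>L 1\<close>; so passing through \<Lambda>
  does not enlarge the kernel.\<close>

lemma rho_eq_iff: "rho x = rho y \<longleftrightarrow> x - y \<in> L 1"
proof
  have "x - y \<in> L 1" if *: "q x \<in> rho y"
  proof -
    obtain z where z: "z - y \<in> L 1" "x - z \<in> I" using * by (auto simp: rho_def q_eq_iff)
    have "(x - z) + (z - y) \<in> L 1" using z I_subset_L1 length_ge_closed(2) by blast
    then show ?thesis by simp
  qed
  moreover have "q x \<in> rho x" by (simp add: rho_def length_ge_closed)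
  ultimately show "rho x = rho y \<Longrightarrow> x - y \<in> L 1" by auto
  have "{z. z - x \<in> L 1} = {z. z - y \<in> L 1} \<longleftrightarrow> x - y \<in> L 1"
    by (rule coset_eq_iff) (auto intro: length_ge_closed)
  then show "x - y \<in> L 1 \<Longrightarrow> rho x = rho y" by (simp add: rho_def)
qed

lemma quiver_radical_eq: "quiver_radical Q I = q ` L 1"
  by (simp add: quiver_radical_def arrow_ideal_eq q_eq)

lemma rho_eq: "quiver_radical Q I +>\<^bsub>\<Lambda>\<^esub> q x = rho x"
proof -
  have "quiver_radical Q I +>\<^bsub>\<Lambda>\<^esub> q x = (\<lambda>h. q (h + x)) ` L 1"
    by (auto simp: a_r_coset_def r_coset_def quiver_radical_eq quiver_algebra_simps)
  also have "\<dots> = rho x"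
  proof -
    have "{z. z - x \<in> L 1} = (\<lambda>h. h + x) ` L 1"
      by (auto intro!: image_eqI[where x = "z - x" for z])
    then show ?thesis by (simp add: rho_def image_image)
  qed
  finally show ?thesis .
qed

lemma rho_zero: "rho 0 = quiver_radical Q I"
  by (simp add: rho_def quiver_radical_eq)

lemma set_add_rho: "set_add \<Lambda> (rho x) (rho y) = rho (x + y)"
proof -
  have "set_add \<Lambda> (rho x) (rho y) =
      q ` set_add (path_algebra Q) {z. z - x \<in> L 1} {z. z - y \<in> L 1}"
    by (auto simp: set_add_def set_mult_def rho_def quiver_algebra_simps path_algebra_simps)
  also have "\<dots> = rho (x + y)"
    unfolding rho_def by (subst set_add_coset) (auto intro: length_ge_closed)
  finally show ?thesis .
qed

abbreviation N where "N \<equiv> top_module Q I"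

lemma mem_rho:
  assumes "x \<in> K" "b \<in> rho x"
  obtains z where "z \<in> K" "z - x \<in> L 1" "b = q z"
proof -
  obtain z where z: "z - x \<in> L 1" "b = q z" using assms(2) by (auto simp: rho_def)
  have "z \<in> K" using K_closed(2)[OF L_in_K[OF z(1)] assms(1)] by simp
  with z that show thesis by blast
qed

lemma top_module_simps:
  "carrier N = rho ` K" "\<zero>\<^bsub>N\<^esub> = rho 0"
  "rho x \<oplus>\<^bsub>N\<^esub> rho y = rho (x + y)"
  "\<lbrakk>x \<in> K; a \<in> K\<rbrakk> \<Longrightarrow> q a \<odot>\<^bsub>N\<^esub> rho x = rho (x \<star> a)"
proof -
  show "carrier N = rho ` K" "\<zero>\<^bsub>N\<^esub> = rho 0" "rho x \<oplus>\<^bsub>N\<^esub> rho y = rho (x + y)"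
    by (auto simp: top_module_def FactRing_def A_RCOSETS_def' rho_zero rho_eq quiver_algebra_simps(1) set_add_rho)
  assume xa: "x \<in> K" "a \<in> K"
  \<comment> \<open>The action is defined as a union over the representatives \<open>b\<close>; they
    differ by elements of the right ideal \<open>L 1\<close>, so all of them yield the same
    coset.\<close>
  have "quiver_radical Q I +>\<^bsub>\<Lambda>\<^esub> (b \<otimes>\<^bsub>\<Lambda>\<^esub> q a) = rho (x \<star> a)" if b: "b \<in> rho x" for b
  proof -
    obtain z where z: "z \<in> K" "z - x \<in> L 1" "b = q z" using mem_rho[OF xa(1) b] .
    then have "z \<star> a - x \<star> a \<in> L 1" using L_closed(1)[OF z(2) xa(2)] xa by (simp add: distr)
    then show ?thesis using z xa by (simp add: quiver_algebra_simps rho_eq rho_eq_iff)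
  qed
  moreover have "q x \<in> rho x" by (simp add: rho_def length_ge_closed)
  ultimately show "q a \<odot>\<^bsub>N\<^esub> rho x = rho (x \<star> a)"
    by (auto simp: top_module_def)
qed

lemma top_proj_q: "x \<in> K \<Longrightarrow> top_proj Q I (q x) = rho x"
  by (auto simp: top_proj_def quiver_algebra_simps(1) rho_eq)

lemma algebra_scalar_eq: "algebra_scalar Q I c = q (pa_scale c one_K)"
  by (simp add: algebra_scalar_def q_eq)

text \<open>The action does not depend on representatives because \<open>z \<star> b - x \<star> a =
  (z - x) \<star> b + x \<star> (b - a)\<close>: the first summand lies in the right ideal
  \<open>B\<close>, the second in \<open>B\<close> because \<open>T\<close> times \<open>I\<close>
  does.\<close>

lemma subquotient_simps:
  assumes T: "T \<subseteq> K" and B: "0 \<in> B" "\<And>x y. \<lbrakk>x \<in> B; y \<in> B\<rbrakk> \<Longrightarrow> x + y \<in> B"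
    "\<And>x y. \<lbrakk>x \<in> B; y \<in> B\<rbrakk> \<Longrightarrow> x - y \<in> B" "\<And>x a. \<lbrakk>x \<in> B; a \<in> K\<rbrakk> \<Longrightarrow> x \<star> a \<in> B"
    and BT: "B \<subseteq> T" and TI: "\<And>x i. \<lbrakk>x \<in> T; i \<in> I\<rbrakk> \<Longrightarrow> x \<star> i \<in> B"
  defines "cl \<equiv> \<lambda>x. {z. z - x \<in> B}"
  shows "carrier (subquotient (path_algebra Q) T B) = cl ` T"
    "\<zero>\<^bsub>subquotient (path_algebra Q) T B\<^esub> = cl 0"
    "cl x \<oplus>\<^bsub>subquotient (path_algebra Q) T B\<^esub> cl y = cl (x + y)"
    "\<lbrakk>x \<in> T; a \<in> K\<rbrakk> \<Longrightarrow> q a \<odot>\<^bsub>subquotient (path_algebra Q) T B\<^esub> cl x = cl (x \<star> a)"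
proof -
  show "carrier (subquotient (path_algebra Q) T B) = cl ` T"
    "\<zero>\<^bsub>subquotient (path_algebra Q) T B\<^esub> = cl 0"
    "cl x \<oplus>\<^bsub>subquotient (path_algebra Q) T B\<^esub> cl y = cl (x + y)"
    using set_add_coset[OF B(1,2)] by (auto simp: subquotient_def coset_altdef cl_def)
  assume xa: "x \<in> T" "a \<in> K"
  have "B +>\<^bsub>path_algebra Q\<^esub> (z \<star> b) = cl (x \<star> a)" if "z \<in> cl x" "b \<in> q a" for z b
  proof -
    have zx: "z - x \<in> B" and ba: "b - a \<in> I" "b \<in> K" and x: "x \<in> K"
      using that xa T mem_coset_q by (auto simp: cl_def q_def)
    have z: "z \<in> K" using K_closed(2)[OF _ x, of "z - x"] zx BT T by auto
    have "(z - x) \<star> b + x \<star> (b - a) \<in> B"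
      by (rule B(2)[OF B(4)[OF zx ba(2)] TI[OF xa(1) ba(1)]])
    then have "z \<star> b - x \<star> a \<in> B"
      using z x ba xa by (simp add: distr)
    then show ?thesis unfolding cl_def coset_altdef by (subst coset_eq_iff) (auto intro: B)
  qed
  moreover have "x \<in> cl x" "a \<in> q a" by (simp_all add: cl_def B self_mem_q)
  ultimately show "q a \<odot>\<^bsub>subquotient (path_algebra Q) T B\<^esub> cl x = cl (x \<star> a)"
    by (auto simp: subquotient_def)
qed

end

section \<open>Components\<close>

locale resolution = quiver_ideal Q I
  for Q :: "('v, 'a) pre_digraph"
    and I :: "(('v, 'a) qpath \<Rightarrow>\<^sub>0 'k::field) set" +
  fixes t :: "nat \<Rightarrow> int"
    and f :: "nat \<Rightarrow> nat \<Rightarrow> (('v, 'a) qpath \<Rightarrow>\<^sub>0 'k)"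
    and c :: "nat \<Rightarrow> nat \<Rightarrow> nat \<Rightarrow> nat \<Rightarrow> nat \<Rightarrow> 'k"
  assumes defines_resolution: "defines_minimal_resolution Q I t f"
    and comultiplicative: "comultiplicative_structure Q t f c"
begin

abbreviation ix :: "nat \<Rightarrow> nat set" where "ix \<equiv> idx t"
abbreviation T where "T n \<equiv> res_top Q t f n"
abbreviation B where "B n \<equiv> res_bot Q I t f n"
abbreviation F where "F n \<equiv> res_module Q I t f n"
abbreviation tm where "tm n i \<equiv> terminus Q (f n i)"

section \<open>Uniqueness of coefficients with respect to the \<open>f n i\<close>\<close>

lemma finite_ix [simp]: "finite (ix n)"
proof (rule finite_subset)
  show "ix n \<subseteq> {..nat (t n)}" by (auto simp: idx_def le_nat_iff)
qed simp

lemma f_uniform: "i \<in> ix n \<Longrightarrow> uniform Q (f n i)"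
  using conjunct1[OF defines_resolution[unfolded defines_minimal_resolution_def]] by simp

text \<open>\<open>terminus\<close> is a definite description, so the end vertex must be shown
  unique: two different end vertices \<open>w\<close> and \<open>v\<close> would give
  \<open>f n i = f n i \<star> (e w \<star> e v) = 0\<close>.\<close>

lemma terminus_props:
  assumes i: "i \<in> ix n"
  shows "f n i \<in> L n" "f n i \<noteq> 0" "f n i \<star> e (tm n i) = f n i" "tm n i \<in> verts Q"
    "homogeneous_of_length n (f n i)"
proof -
  have hom: "homogeneous_of_length n (f n i)"
    using defines_resolution i by (auto simp: defines_minimal_resolution_def)
  obtain u v where uv: "uniform_between Q (f n i) u v"
    using f_uniform[OF i] by (auto simp: uniform_def)
  have end_mult: "f n i \<star> e w = f n i \<and> w \<in> verts Q \<and> f n i \<in> K \<and> f n i \<noteq> 0"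
    if "uniform_between Q (f n i) u' w" for u' w
  proof -
    have K: "f n i \<in> K" "u' \<in> verts Q" "w \<in> verts Q" "f n i = e u' \<star> f n i \<star> e w" "f n i \<noteq> 0"
      using that by (auto simp: uniform_between_def)
    have "f n i \<star> e w = e u' \<star> f n i \<star> e w \<star> e w" by (rule arg_cong[OF K(4)])
    also have "\<dots> = e u' \<star> f n i \<star> e w"
      using K(1-3) by (simp add: R.m_assoc vertex_elt_closed vertex_elt_mult)
    also have "\<dots> = f n i" by (rule K(4)[symmetric])
    finally show ?thesis using K by blast
  qed
  have uniq: "w = v" if "uniform_between Q (f n i) u' w" for u' w
  proof (rule ccontr)
    assume "w \<noteq> v"
    have w: "f n i \<star> e w = f n i" "w \<in> verts Q" and v: "f n i \<star> e v = f n i" "v \<in> verts Q"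
      and K: "f n i \<in> K" "f n i \<noteq> 0"
      using end_mult[OF that] end_mult[OF uv] by auto
    have "f n i = f n i \<star> (e w \<star> e v)"
      using R.m_assoc[OF K(1) vertex_elt_closed[OF w(2)] vertex_elt_closed[OF v(2)]]
      by (simp only: w v)
    with \<open>w \<noteq> v\<close> K show False by (simp add: vertex_elt_mult)
  qed
  have "tm n i = v"
    unfolding terminus_def by (rule the_equality) (use uv uniq in blast)+
  with end_mult[OF uv] hom
  show "f n i \<in> L n" "f n i \<noteq> 0" "f n i \<star> e (tm n i) = f n i" "tm n i \<in> verts Q"
    "homogeneous_of_length n (f n i)"
    by (auto simp: length_ge_def homogeneous_of_length_def)
qed

lemma f_in_K [simp]: "i \<in> ix n \<Longrightarrow> f n i \<in> K"
  by (rule L_in_K[OF terminus_props(1)])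

lemma e_tm_in_K [simp]: "i \<in> ix n \<Longrightarrow> e (tm n i) \<in> K"
  by (rule vertex_elt_closed[OF terminus_props(4)])

text \<open>Directness gives \<open>f n i \<star> s i = 0\<close>; as \<open>f n i\<close> is
  homogeneous and nonzero, it can be cancelled down to its end vertex.\<close>

lemma direct:
  assumes "\<And>i. i \<in> ix n \<Longrightarrow> s i \<in> K" "(\<Sum>i\<in>ix n. f n i \<star> s i) = 0" "i \<in> ix n"
  shows "e (tm n i) \<star> s i = 0"
proof -
  have "direct_right_ideals (path_algebra Q) (ix n) (f n)"
    using defines_resolution by (simp add: defines_minimal_resolution_def)
  moreover have "finsum (path_algebra Q) (\<lambda>i. f n i \<star> s i) (ix n) = 0"
    using assms by (subst finsum_eq_sum) auto
  moreover have "s \<in> ix n \<rightarrow> K" using assms(1) by (rule Pi_I)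
  ultimately have "f n i \<star> s i = 0"
    unfolding direct_right_ideals_def path_algebra_simps(2) using assms(3) by blast
  then show ?thesis
    using terminus_props[OF assms(3)] by (intro mult_eq_0_homogeneous[of n "f n i"]) auto
qed

lemma split_length:
  assumes "s \<in> K"
  obtains l h where "l \<in> K" "h \<in> L d" "s = l + h" "\<And>p. p \<in> Poly_Mapping.keys l \<Longrightarrow> length (snd p) < d"
proof -
  define l where "l = (\<Sum>p\<in>{p \<in> Poly_Mapping.keys s. length (snd p) < d}. Poly_Mapping.single p (Poly_Mapping.lookup s p))"
  have lookup_l: "Poly_Mapping.lookup l p = (if length (snd p) < d then Poly_Mapping.lookup s p else 0)" for p
    by (simp add: l_def lookup_sum lookup_single when_def sum.delta in_keys_iff)
  have keys_l: "p \<in> Poly_Mapping.keys l \<Longrightarrow> p \<in> Poly_Mapping.keys s \<and> length (snd p) < d" for p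
    by (auto simp: in_keys_iff lookup_l split: if_splits)
  have keys_h: "p \<in> Poly_Mapping.keys (s - l) \<Longrightarrow> p \<in> Poly_Mapping.keys s \<and> d \<le> length (snd p)" for p
    by (auto simp: in_keys_iff lookup_l lookup_minus split: if_splits)
  show thesis
    by (rule that[of l "s - l"])
       (use keys_l keys_h assms in \<open>auto simp: length_ge_def path_algebra_simps(1)\<close>)
qed

text \<open>Comparing the parts of length less than \<open>n + d\<close> reduces this to directness of the sum.\<close>

lemma direct_L:
  assumes s: "\<And>i. i \<in> ix n \<Longrightarrow> s i \<in> K" and sum: "(\<Sum>i\<in>ix n. f n i \<star> s i) \<in> L (n + d)"
    and i: "i \<in> ix n"
  shows "e (tm n i) \<star> s i \<in> L d"
proof -
  have "\<exists>l h. l \<in> K \<and> h \<in> L d \<and> s i = l + h \<and> (\<forall>p\<in>Poly_Mapping.keys l. length (snd p) < d)"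
    if "i \<in> ix n" for i
    using split_length[OF s[OF that], of d] by metis
  then obtain l h where lh: "\<And>i. i \<in> ix n \<Longrightarrow> l i \<in> K \<and> h i \<in> L d \<and> s i = l i + h i"
    "\<And>i p. i \<in> ix n \<Longrightarrow> p \<in> Poly_Mapping.keys (l i) \<Longrightarrow> length (snd p) < d"
    by metis
  have K: "l i \<in> K" "h i \<in> K" if "i \<in> ix n" for i using lh(1)[OF that] L_in_K by auto
  define x where "x = (\<Sum>i\<in>ix n. f n i \<star> l i)"
  have "x = (\<Sum>i\<in>ix n. f n i \<star> s i) - (\<Sum>i\<in>ix n. f n i \<star> h i)"
    using lh(1) K by (simp add: x_def distr flip: sum_subtractf)
  moreover have "(\<Sum>i\<in>ix n. f n i \<star> h i) \<in> L (n + d)"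
    using lh(1) L_mult terminus_props(1) by (intro length_ge_sum) auto
  ultimately have xL: "x \<in> L (n + d)" using sum length_ge_closed(3) by auto
  have short: "length (snd p) < n + d" if p: "p \<in> Poly_Mapping.keys x" for p
  proof -
    have "Poly_Mapping.lookup x p \<noteq> 0" using p by (simp add: in_keys_iff)
    then obtain i where i: "i \<in> ix n" "p \<in> Poly_Mapping.keys (f n i \<star> l i)"
      unfolding x_def lookup_sum by (metis (mono_tags) in_keys_iff sum.neutral)
    from keys_path_algebra_mult[OF i(2)] obtain p1 p2 where
      "p1 \<in> Poly_Mapping.keys (f n i)" "p2 \<in> Poly_Mapping.keys (l i)" "p = (fst p1, snd p1 @ snd p2)"
      by metis
    then show ?thesis
      using terminus_props(5)[OF i(1)] lh(2)[OF i(1)] by (auto simp: homogeneous_of_length_def)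
  qed
  have "x = 0"
  proof (rule ccontr)
    assume "x \<noteq> 0"
    then obtain p where "p \<in> Poly_Mapping.keys x" by (metis all_not_in_conv keys_eq_empty)
    with short[of p] xL show False by (auto simp: length_ge_def)
  qed
  then have "e (tm n i) \<star> l i = 0" using direct[of n l i] K i by (simp add: x_def)
  then show ?thesis using lh(1)[OF i] K[OF i] i by (simp add: distr L_closed)
qed

text \<open>
  Every \<open>y\<close> in the right ideal generated by the \<open>f\<^sup>n\<^sub>i\<close> is uniquely of the form
  \<open>\<Sum>i. f\<^sup>n\<^sub>i y\<^sub>i\<close> with \<open>y\<^sub>i = \<tt>(f\<^sup>n\<^sub>i) y\<^sub>i\<close>; the element \<open>y\<^sub>i\<close> is \<open>component n i y\<close>.
\<close>

definition component :: "nat \<Rightarrow> nat \<Rightarrow> (('v, 'a) qpath \<Rightarrow>\<^sub>0 'k) \<Rightarrow> (('v, 'a) qpath \<Rightarrow>\<^sub>0 'k)" where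
  "component n i y = e (tm n i) \<star>
     (SOME s. (\<forall>j\<in>ix n. s j \<in> K) \<and> y = (\<Sum>j\<in>ix n. f n j \<star> s j)) i"

lemma sum_times_eq:
  assumes "S \<subseteq> K"
  shows "sum_times (path_algebra Q) (ix n) (f n) S =
     {\<Sum>i\<in>ix n. f n i \<star> s i |s. \<forall>i\<in>ix n. s i \<in> S}"
proof -
  have eq: "finsum (path_algebra Q) (\<lambda>i. f n i \<star> s i) (ix n) = (\<Sum>i\<in>ix n. f n i \<star> s i)"
    if "\<forall>i\<in>ix n. s i \<in> S" for s
    using that assms by (intro finsum_eq_sum) auto
  show ?thesis
    unfolding sum_times_def Pi_iff using eq by (intro Collect_cong ex_cong1) (auto simp only:)
qed

lemma T_eq: "T n = {\<Sum>i\<in>ix n. f n i \<star> s i |s. \<forall>i\<in>ix n. s i \<in> K}"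
  unfolding res_top_def by (rule sum_times_eq) simp

lemma B_eq: "B n = {\<Sum>i\<in>ix n. f n i \<star> s i |s. \<forall>i\<in>ix n. s i \<in> I}"
  unfolding res_bot_def using I_closed(2) by (intro sum_times_eq) auto

lemma T_I:
  assumes "y = (\<Sum>i\<in>ix n. f n i \<star> s i)" "\<And>i. i \<in> ix n \<Longrightarrow> s i \<in> K"
  shows "y \<in> T n"
  unfolding T_eq mem_Collect_eq using assms by (intro exI[of _ s] conjI ballI)

lemma B_I:
  assumes "y = (\<Sum>i\<in>ix n. f n i \<star> s i)" "\<And>i. i \<in> ix n \<Longrightarrow> s i \<in> I"
  shows "y \<in> B n"
  unfolding B_eq mem_Collect_eq using assms by (intro exI[of _ s] conjI ballI)

lemma B_E:
  assumes "y \<in> B n"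
  obtains s where "y = (\<Sum>i\<in>ix n. f n i \<star> s i)" "\<And>i. i \<in> ix n \<Longrightarrow> s i \<in> I"
  using assms unfolding B_eq by blast

text \<open>Two coefficient families for the same element differ by a relation, and by
  \<open>direct\<close> the left factor \<open>e (tm n i)\<close> annihilates the difference. Hence
  the choice in \<open>component\<close> is harmless, and any family of coefficients computes
  it.\<close>

lemma component_eqI:
  assumes s: "\<And>j. j \<in> ix n \<Longrightarrow> s j \<in> K" and y: "y = (\<Sum>j\<in>ix n. f n j \<star> s j)" and i: "i \<in> ix n"
  shows "component n i y = e (tm n i) \<star> s i"
proof -
  define s' where "s' = (SOME s. (\<forall>j\<in>ix n. s j \<in> K) \<and> y = (\<Sum>j\<in>ix n. f n j \<star> s j))"
  have s': "(\<forall>j\<in>ix n. s' j \<in> K) \<and> y = (\<Sum>j\<in>ix n. f n j \<star> s' j)"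
    unfolding s'_def by (rule someI[of _ s]) (use s y in auto)
  have "(\<Sum>j\<in>ix n. f n j \<star> (s' j - s j)) = y - y"
    using s s' y by (simp add: distr sum_subtractf)
  then have "e (tm n i) \<star> (s' i - s i) = 0"
    using s s' i by (intro direct) auto
  then have "e (tm n i) \<star> s' i = e (tm n i) \<star> s i"
    using s s' i by (simp add: distr)
  then show ?thesis by (simp only: component_def s'_def)
qed

lemma component_props:
  assumes y: "y \<in> T n"
  shows "i \<in> ix n \<Longrightarrow> component n i y \<in> K"
    and "i \<in> ix n \<Longrightarrow> e (tm n i) \<star> component n i y = component n i y"
    and "(\<Sum>i\<in>ix n. f n i \<star> component n i y) = y"
proof -
  obtain s where s: "\<And>i. i \<in> ix n \<Longrightarrow> s i \<in> K" "y = (\<Sum>i\<in>ix n. f n i \<star> s i)"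
    using y by (auto simp: T_eq)
  have eq: "component n i y = e (tm n i) \<star> s i" if "i \<in> ix n" for i
    using component_eqI[OF s that] .
  show K: "component n i y \<in> K" if "i \<in> ix n" for i using eq[OF that] s(1)[OF that] that by simp
  show "e (tm n i) \<star> component n i y = component n i y" if "i \<in> ix n" for i
    using eq[OF that] s(1)[OF that] that by (simp add: vertex_elt_mult flip: R.m_assoc)
  have "f n i \<star> component n i y = f n i \<star> s i" if "i \<in> ix n" for i
    using eq[OF that] s(1)[OF that] that terminus_props(3)[OF that] by (simp flip: R.m_assoc)
  then show "(\<Sum>i\<in>ix n. f n i \<star> component n i y) = y" using s(2) by simp
qed

section \<open>Components as right linear maps, and the right ideals \<open>T n\<close> and
  \<open>B n\<close>\<close>

lemma T_in_L: "y \<in> T n \<Longrightarrow> y \<in> L n"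
  using terminus_props(1) L_closed(1) by (auto simp: T_eq intro!: length_ge_sum)

lemma T_in_K: "y \<in> T n \<Longrightarrow> y \<in> K"
  using T_in_L L_in_K by blast

text \<open>Each operation is performed on the coefficients \<open>component n i x\<close>. The
  resulting expansion shows membership in \<open>T n\<close>, and \<open>component_eqI\<close> reads
  the new components off it.\<close>

lemma T_closed:
  shows "\<lbrakk>x \<in> T n; y \<in> T n\<rbrakk> \<Longrightarrow> x + y \<in> T n" "\<lbrakk>x \<in> T n; y \<in> T n\<rbrakk> \<Longrightarrow> x - y \<in> T n"
    "\<lbrakk>x \<in> T n; a \<in> K\<rbrakk> \<Longrightarrow> x \<star> a \<in> T n" "0 \<in> T n"
    and component_add: "\<lbrakk>x \<in> T n; y \<in> T n; i \<in> ix n\<rbrakk> \<Longrightarrow> component n i (x + y) = component n i x + component n i y"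
    and component_diff: "\<lbrakk>x \<in> T n; y \<in> T n; i \<in> ix n\<rbrakk> \<Longrightarrow> component n i (x - y) = component n i x - component n i y"
    and component_mult: "\<lbrakk>x \<in> T n; a \<in> K; i \<in> ix n\<rbrakk> \<Longrightarrow> component n i (x \<star> a) = component n i x \<star> a"
    and component_0: "i \<in> ix n \<Longrightarrow> component n i 0 = 0"
proof -
  note K = component_props(1)
  have add: "x + y = (\<Sum>i\<in>ix n. f n i \<star> (component n i x + component n i y))"
    and diff: "x - y = (\<Sum>i\<in>ix n. f n i \<star> (component n i x - component n i y))"
    if "x \<in> T n" "y \<in> T n" for x y
    using that component_props(3)[OF that(1)] component_props(3)[OF that(2)] K
    by (simp_all add: distr sum.distrib sum_subtractf)
  have mult: "x \<star> a = (\<Sum>i\<in>ix n. f n i \<star> (component n i x \<star> a))" if "x \<in> T n" "a \<in> K" for x a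
  proof -
    have "x \<star> a = (\<Sum>i\<in>ix n. f n i \<star> component n i x) \<star> a"
      by (simp add: component_props(3)[OF that(1)])
    also have "\<dots> = (\<Sum>i\<in>ix n. f n i \<star> (component n i x \<star> a))"
      using that K by (subst sum_distr) (auto intro!: sum.cong R.m_assoc)
    finally show ?thesis .
  qed
  show "x + y \<in> T n" "x - y \<in> T n" if "x \<in> T n" "y \<in> T n" for x y
    using T_I[OF add[OF that]] T_I[OF diff[OF that]] K that by auto
  show "x \<star> a \<in> T n" if "x \<in> T n" "a \<in> K" for x a
    using T_I[OF mult[OF that]] K that by auto
  have "0 = (\<Sum>i\<in>ix n. f n i \<star> 0)" by simp
  then show "0 \<in> T n" by (rule T_I) simp
  show "component n i (x + y) = component n i x + component n i y"
    "component n i (x - y) = component n i x - component n i y"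
    if "x \<in> T n" "y \<in> T n" "i \<in> ix n" for x y
    using component_eqI[OF _ add[OF that(1,2)] that(3)] component_eqI[OF _ diff[OF that(1,2)] that(3)]
      K that component_props(2) by (auto simp: distr)
  show "component n i (x \<star> a) = component n i x \<star> a" if "x \<in> T n" "a \<in> K" "i \<in> ix n" for x a
    using component_eqI[OF _ mult[OF that(1,2)] that(3)] K that component_props(2)
    by (simp flip: R.m_assoc)
  show "component n i 0 = 0" if "i \<in> ix n"
    using component_eqI[of n "\<lambda>_. 0" 0 i] that by simp
qed

lemma T_sum: "(\<And>i. i \<in> A \<Longrightarrow> g i \<in> T n) \<Longrightarrow> sum g A \<in> T n"
  by (induction A rule: infinite_finite_induct) (auto simp: T_closed)

lemma component_sum:
  "\<lbrakk>\<And>j. j \<in> A \<Longrightarrow> g j \<in> T n; i \<in> ix n\<rbrakk> \<Longrightarrow> component n i (sum g A) = (\<Sum>j\<in>A. component n i (g j))"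
  by (induction A rule: infinite_finite_induct) (auto simp: component_0 component_add T_sum)

text \<open>Stripping the left factors \<open>f n i\<close> lowers path length by \<open>n\<close>;
  error estimates in \<open>T n\<close> thereby become estimates for the coefficients.\<close>

lemma component_L: "\<lbrakk>y \<in> T n; y \<in> L (n + d); i \<in> ix n\<rbrakk> \<Longrightarrow> component n i y \<in> L d"
  using direct_L[of n "\<lambda>i. component n i y" d i] component_props by simp

lemma f_eq_sum: "i \<in> ix n \<Longrightarrow> f n i = (\<Sum>j\<in>ix n. f n j \<star> (if j = i then e (tm n i) else 0))"
  using terminus_props(3) by (simp add: if_distrib sum.delta cong: if_cong)

lemma f_in_T: "i \<in> ix n \<Longrightarrow> f n i \<in> T n"
  by (rule T_I[OF f_eq_sum]) auto

lemma component_f: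
  assumes "i \<in> ix n" "j \<in> ix n"
  shows "component n j (f n i) = (if j = i then e (tm n i) else 0)"
  using component_eqI[OF _ f_eq_sum[OF assms(1)] assms(2)] assms(1) by (auto simp: vertex_elt_mult)

lemma T_mult_I:
  assumes xa: "x \<in> T n" "a \<in> I"
  shows "x \<star> a \<in> B n"
proof (rule B_I)
  show "x \<star> a = (\<Sum>i\<in>ix n. f n i \<star> component n i (x \<star> a))"
    using component_props(3)[of "x \<star> a" n] T_closed(3) xa I_closed(2) by simp
  show "component n i (x \<star> a) \<in> I" if "i \<in> ix n" for i
    using xa that I_closed(2,6) component_mult component_props(1) by auto
qed

text \<open>Coefficients in \<open>I\<close> stay in \<open>I\<close> after multiplication by a
  vertex, so the normalised ones can be tested. Closure properties of \<open>B n\<close> then come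
  from those of \<open>I\<close>.\<close>

lemma mem_B_iff: "y \<in> B n \<longleftrightarrow> y \<in> T n \<and> (\<forall>i\<in>ix n. component n i y \<in> I)"
proof (intro iffI conjI ballI)
  assume y: "y \<in> B n"
  obtain s where s: "y = (\<Sum>i\<in>ix n. f n i \<star> s i)" "\<And>i. i \<in> ix n \<Longrightarrow> s i \<in> I"
    using B_E[OF y] by blast
  then have sK: "\<And>i. i \<in> ix n \<Longrightarrow> s i \<in> K" using I_closed(2) by blast
  show "y \<in> T n" by (rule T_I[OF s(1) sK])
  fix i assume i: "i \<in> ix n"
  show "component n i y \<in> I"
    using component_eqI[OF sK s(1) i] s(2)[OF i] i by (simp add: I_closed)
next
  assume *: "y \<in> T n \<and> (\<forall>i\<in>ix n. component n i y \<in> I)"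
  then show "y \<in> B n" using component_props(3)[of y n] by (intro B_I[of y n "\<lambda>i. component n i y"]) auto
qed

lemma B_subset_T: "B n \<subseteq> T n"
  by (auto simp: mem_B_iff)

lemma B_closed:
  shows "\<lbrakk>x \<in> B n; y \<in> B n\<rbrakk> \<Longrightarrow> x + y \<in> B n" "\<lbrakk>x \<in> B n; y \<in> B n\<rbrakk> \<Longrightarrow> x - y \<in> B n"
    "\<lbrakk>x \<in> B n; a \<in> K\<rbrakk> \<Longrightarrow> x \<star> a \<in> B n" "0 \<in> B n"
  by (auto simp: mem_B_iff T_closed component_add component_diff component_mult component_0 I_closed)

lemma B_sum: "(\<And>i. i \<in> A \<Longrightarrow> g i \<in> B n) \<Longrightarrow> sum g A \<in> B n"
  by (induction A rule: infinite_finite_induct) (auto simp: B_closed)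

text \<open>The \<open>f n i\<close> have length \<open>n\<close> and \<open>I\<close> starts in
  length 2. So a class in \<open>F n\<close> fixes its representative up to paths at least two
  longer than \<open>n\<close>.\<close>

lemma B_in_L:
  assumes "y \<in> B n"
  shows "y \<in> L (n + 2)"
proof -
  obtain s where s: "y = (\<Sum>i\<in>ix n. f n i \<star> s i)" "\<And>i. i \<in> ix n \<Longrightarrow> s i \<in> I"
    using B_E[OF assms] by blast
  show ?thesis
    unfolding s(1) by (intro length_ge_sum L_mult terminus_props(1)) (use s(2) I_subset_L in auto)
qed

section \<open>The modules \<open>F n\<close> as quotients of \<open>T n\<close>, with projection
  \<open>cl n\<close>\<close>

definition cl :: "nat \<Rightarrow> (('v, 'a) qpath \<Rightarrow>\<^sub>0 'k) \<Rightarrow> (('v, 'a) qpath \<Rightarrow>\<^sub>0 'k) set" where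
  "cl n x = {z. z - x \<in> B n}"

abbreviation d where "d n \<equiv> res_diff Q I t f n"

lemma cl_eq_iff: "cl n x = cl n y \<longleftrightarrow> x - y \<in> B n"
  unfolding cl_def by (rule coset_eq_iff) (auto intro: B_closed)

lemma res_module_simps:
  "carrier (F n) = cl n ` T n"
  "cl n x \<oplus>\<^bsub>F n\<^esub> cl n y = cl n (x + y)"
  "\<lbrakk>x \<in> T n; a \<in> K\<rbrakk> \<Longrightarrow> q a \<odot>\<^bsub>F n\<^esub> cl n x = cl n (x \<star> a)"
proof -
  have "T n \<subseteq> K" using T_in_K by blast
  note simps = subquotient_simps[OF this B_closed(4,1,2,3) B_subset_T T_mult_I]
  show "carrier (F n) = cl n ` T n" "cl n x \<oplus>\<^bsub>F n\<^esub> cl n y = cl n (x + y)"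
    "\<lbrakk>x \<in> T n; a \<in> K\<rbrakk> \<Longrightarrow> q a \<odot>\<^bsub>F n\<^esub> cl n x = cl n (x \<star> a)"
    using simps(1,3,4) by (simp_all add: res_module_def cl_def)
qed

lemma self_mem_cl: "x \<in> cl n x"
  by (simp add: cl_def B_closed)

section \<open>The chain of right ideals: differentials and comultiplicative structure\<close>

lemma T_Suc: "T (Suc n) \<subseteq> T n"
  using defines_resolution by (simp add: defines_minimal_resolution_def)

lemma T_add: "T (n + r) \<subseteq> T n"
  by (rule lift_Suc_antimono_le[of T, OF T_Suc]) simp

text \<open>Each \<open>f (Suc n) i\<close> lies in \<open>T n\<close>, and \<open>T n\<close> times
  \<open>I\<close> lies in \<open>B n\<close>. This makes the inclusion of \<open>T (Suc n)\<close>
  into \<open>T n\<close> descend to classes.\<close>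

lemma B_Suc: "B (Suc n) \<subseteq> B n"
proof
  fix y assume "y \<in> B (Suc n)"
  from B_E[OF this] obtain s where s: "y = (\<Sum>i\<in>ix (Suc n). f (Suc n) i \<star> s i)"
    "\<And>i. i \<in> ix (Suc n) \<Longrightarrow> s i \<in> I" by blast
  show "y \<in> B n" unfolding s(1)
    using f_in_T[of _ "Suc n"] T_Suc s(2) by (intro B_sum T_mult_I) auto
qed

lemma res_diff_cl:
  assumes x: "x \<in> T (Suc n)"
  shows "d (Suc n) (cl (Suc n) x) = cl n x"
proof -
  have "B n +>\<^bsub>path_algebra Q\<^esub> z = cl n x" if "z \<in> cl (Suc n) x" for z
  proof -
    have "z - x \<in> B n" using that B_Suc by (auto simp: cl_def)
    then show ?thesis by (simp add: coset_altdef cl_eq_iff flip: cl_def)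
  qed
  then have "(\<Union>z\<in>cl (Suc n) x. B n +>\<^bsub>path_algebra Q\<^esub> z) = cl n x"
    using self_mem_cl[of x "Suc n"] by auto
  then show ?thesis using x by (simp add: res_diff_def res_module_simps)
qed

text \<open>Grouping the comultiplication formula by its first factor \<open>f n p\<close> exhibits
  the sum over \<open>i\<close> as a coefficient of \<open>f n p\<close>. It remains to see that the
  vertex \<open>e (tm n p)\<close> fixes every term of this sum.\<close>

lemma component_f_comult:
  assumes l: "l \<in> ix (n + r)" and p: "p \<in> ix n"
  shows "component n p (f (n + r) l) = (\<Sum>i\<in>ix r. pa_scale (c p i (n + r) l n) (f r i))"
proof -
  let ?G = "\<lambda>p. \<Sum>i\<in>ix r. pa_scale (c p i (n + r) l n) (f r i)"
  have c: "f (n + r) l = finsum (path_algebra Q) (\<lambda>p. finsum (path_algebra Q)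
        (\<lambda>i. pa_scale (c p i (n + r) l n) (f n p \<star> f r i)) (ix r)) (ix n)"
    and c0: "\<And>p i. \<lbrakk>p \<in> ix n; i \<in> ix r; f n p \<star> f r i = 0\<rbrakk> \<Longrightarrow> c p i (n + r) l n = 0"
    using comultiplicative[unfolded comultiplicative_structure_def, rule_format, OF l, of n]
    by (simp_all add: path_algebra_simps(2))
  have inner: "finsum (path_algebra Q) (\<lambda>i. pa_scale (c p i (n + r) l n) (f n p \<star> f r i)) (ix r)
      = f n p \<star> ?G p" if "p \<in> ix n" for p
  proof -
    have "finsum (path_algebra Q) (\<lambda>i. pa_scale (c p i (n + r) l n) (f n p \<star> f r i)) (ix r)
        = (\<Sum>i\<in>ix r. pa_scale (c p i (n + r) l n) (f n p \<star> f r i))"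
      using that by (intro finsum_eq_sum) auto
    also have "\<dots> = f n p \<star> ?G p"
      using that by (subst sum_distr(2)) (auto simp: pa_scale_mult_right)
    finally show ?thesis .
  qed
  have G: "?G p \<in> K" for p by (intro K_sum K_closed) auto
  have "finsum (path_algebra Q) (\<lambda>p. finsum (path_algebra Q)
        (\<lambda>i. pa_scale (c p i (n + r) l n) (f n p \<star> f r i)) (ix r)) (ix n)
      = finsum (path_algebra Q) (\<lambda>p. f n p \<star> ?G p) (ix n)"
    using inner G by (intro R.finsum_cong') auto
  then have "f (n + r) l = (\<Sum>p\<in>ix n. f n p \<star> ?G p)"
    using c G by (simp add: finsum_eq_sum)
  then have "component n p (f (n + r) l) = e (tm n p) \<star> ?G p"
    using G p by (intro component_eqI)
  also have "\<dots> = (\<Sum>i\<in>ix r. e (tm n p) \<star> pa_scale (c p i (n + r) l n) (f r i))"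
    using p by (subst sum_distr(2)) auto
  also have "\<dots> = ?G p"
  proof (rule sum.cong[OF refl])
    fix i assume i: "i \<in> ix r"
    show "e (tm n p) \<star> pa_scale (c p i (n + r) l n) (f r i) = pa_scale (c p i (n + r) l n) (f r i)"
    proof (cases "c p i (n + r) l n = 0")
      \<comment> \<open>By convention a nonzero coefficient occurs only if
        \<open>f n p \<star> f r i\<close> is nonzero, which forces the start vertex
        \<open>u\<close> of \<open>f r i\<close> to be the end vertex of
        \<open>f n p\<close>.\<close>
      case False
      then have nz: "f n p \<star> f r i \<noteq> 0" using c0[OF p i] by blast
      obtain u v where uv: "uniform_between Q (f r i) u v"
        using f_uniform[OF i] unfolding uniform_def by blast
      then have u: "u \<in> verts Q" "v \<in> verts Q" "f r i = e u \<star> f r i \<star> e v"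
        by (auto simp: uniform_between_def)
      have left: "e w \<star> f r i = e w \<star> e u \<star> f r i \<star> e v" if "w \<in> verts Q" for w
      proof -
        have "e w \<star> f r i = e w \<star> (e u \<star> f r i \<star> e v)" by (rule arg_cong[OF u(3)])
        also have "\<dots> = e w \<star> e u \<star> f r i \<star> e v"
          using i u(1,2) that by (simp add: R.m_assoc vertex_elt_closed)
        finally show ?thesis .
      qed
      have "tm n p = u"
      proof (rule ccontr)
        assume "tm n p \<noteq> u"
        then have "e (tm n p) \<star> f r i = 0"
          using left[OF terminus_props(4)[OF p]] by (simp add: vertex_elt_mult)
        then have "f n p \<star> e (tm n p) \<star> f r i = 0" using p i by (simp add: R.m_assoc)
        with nz show False by (simp add: terminus_props(3)[OF p])
      qed
      then have "e (tm n p) \<star> f r i = f r i"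
        using left[OF u(1)] u(3)[symmetric] by (simp add: vertex_elt_mult)
      then show ?thesis by (simp add: pa_scale_mult_right)
    qed simp
  qed
  finally show ?thesis .
qed

text \<open>Scaling is right multiplication by a multiple of 1, so right linearity covers
  it.\<close>

lemma T_scale: "x \<in> T n \<Longrightarrow> pa_scale a x \<in> T n"
  using T_closed(3)[of x n "pa_scale a one_K"] mul_pa_scale_one[OF T_in_K] by simp

lemma component_scale: "\<lbrakk>x \<in> T n; i \<in> ix n\<rbrakk> \<Longrightarrow> component n i (pa_scale a x) = pa_scale a (component n i x)"
  using component_mult[of x n "pa_scale a one_K" i] mul_pa_scale_one[OF T_in_K]
    mul_pa_scale_one[OF component_props(1)] by simp

text \<open>By right linearity on \<open>T n\<close>, the map \<open>component n p\<close> is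
  determined on \<open>T (n + r)\<close> by its values at the \<open>f (n + r) l\<close>, which the
  comultiplicative structure provides.\<close>

lemma component_expand:
  assumes y: "y \<in> T (n + r)" and p: "p \<in> ix n"
  shows "component n p y = (\<Sum>l\<in>ix (n + r). component n p (f (n + r) l) \<star> component (n + r) l y)"
proof -
  have fT: "f (n + r) l \<in> T n" if "l \<in> ix (n + r)" for l
    using f_in_T[OF that] T_add by blast
  have "component n p y = component n p (\<Sum>l\<in>ix (n + r). f (n + r) l \<star> component (n + r) l y)"
    by (simp add: component_props(3)[OF y])
  also have "\<dots> = (\<Sum>l\<in>ix (n + r). component n p (f (n + r) l \<star> component (n + r) l y))"
    using fT p component_props(1)[OF y] by (intro component_sum T_closed(3))
  also have "\<dots> = (\<Sum>l\<in>ix (n + r). component n p (f (n + r) l) \<star> component (n + r) l y)"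
    using fT p component_props(1)[OF y] by (intro sum.cong component_mult refl)
  finally show ?thesis .
qed

lemma component_f_in_T: "\<lbrakk>l \<in> ix (n + r); p \<in> ix n\<rbrakk> \<Longrightarrow> component n p (f (n + r) l) \<in> T r"
  by (auto simp: component_f_comult intro!: T_sum T_scale f_in_T)

text \<open>The \<open>f (n + r) l\<close> are sent to combinations of the \<open>f r i\<close>, and
  right linearity does the rest. With \<open>component_in_B\<close>, the map
  \<open>component n p\<close> thus induces one from \<open>F (n + r)\<close> to
  \<open>F r\<close>.\<close>

lemma component_in_T: "\<lbrakk>y \<in> T (n + r); p \<in> ix n\<rbrakk> \<Longrightarrow> component n p y \<in> T r"
  by (subst component_expand) (auto intro!: T_sum T_closed(3) component_f_in_T component_props(1))

lemma component_in_B: "\<lbrakk>y \<in> B (n + r); p \<in> ix n\<rbrakk> \<Longrightarrow> component n p y \<in> B r"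
  by (subst component_expand)
     (use B_subset_T in \<open>auto simp: mem_B_iff[of _ "n + r"] intro!: B_sum T_mult_I component_f_in_T\<close>)

text \<open>The component of \<open>f (n + m) l\<close> at \<open>j\<close> is a combination of the
  \<open>f m p\<close>, whose component at \<open>i\<close> keeps the term \<open>p = i\<close>
  alone: the structure coefficient times a vertex.\<close>

lemma component_component:
  assumes y: "y \<in> T (n + m)" and j: "j \<in> ix n" and i: "i \<in> ix m"
  shows "component m i (component n j y) =
    (\<Sum>l\<in>ix (n + m). pa_scale (c j i (n + m) l n) (component (n + m) l y))"
proof -
  let ?c = "\<lambda>l. c j i (n + m) l n"
  have cc: "component m i (component n j (f (n + m) l)) = pa_scale (?c l) (e (tm m i))"
    if l: "l \<in> ix (n + m)" for l
  proof -
    have "component m i (component n j (f (n + m) l)) =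
        (\<Sum>p\<in>ix m. component m i (pa_scale (c j p (n + m) l n) (f m p)))"
      unfolding component_f_comult[OF l j] using i by (intro component_sum T_scale f_in_T)
    also have "\<dots> = (\<Sum>p\<in>ix m. if p = i then pa_scale (?c l) (e (tm m i)) else 0)"
      using i by (intro sum.cong) (auto simp: component_scale f_in_T component_f)
    finally show ?thesis using i by simp
  qed
  have cs: "pa_scale (?c l) (e (tm m i)) \<star> component (n + m) l y = pa_scale (?c l) (component (n + m) l y)"
    if l: "l \<in> ix (n + m)" for l
  proof (cases "?c l = 0")
    case False
    have fT: "f (n + m) l \<in> T n" using f_in_T[OF l] T_add by blast
    \<comment> \<open>If the end vertices differed, multiplying \<open>f (n + m) l\<close> on the
      right by its own end vertex would turn the nonzero multiple of \<open>e (tm m i)\<close> found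
      in \<open>cc\<close> into 0.\<close>
    have "tm m i = tm (n + m) l"
    proof (rule ccontr)
      assume ne: "tm m i \<noteq> tm (n + m) l"
      have "pa_scale (?c l) (e (tm m i)) = component m i (component n j (f (n + m) l \<star> e (tm (n + m) l)))"
        using cc[OF l] terminus_props(3)[OF l] by simp
      also have "\<dots> = component m i (component n j (f (n + m) l)) \<star> e (tm (n + m) l)"
        using i j l fT component_f_in_T[OF l j] by (simp add: component_mult)
      also have "\<dots> = 0"
        using ne by (simp add: cc[OF l] pa_scale_mult_left vertex_elt_mult)
      finally have "Poly_Mapping.lookup (pa_scale (?c l) (e (tm m i))) (tm m i, []) = 0" by simp
      with False show False by (simp add: vertex_elt_def)
    qed
    then show ?thesis using component_props(2)[OF y l] by (simp add: pa_scale_mult_left)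
  qed simp
  have "component m i (component n j y) =
      (\<Sum>l\<in>ix (n + m). component m i (component n j (f (n + m) l) \<star> component (n + m) l y))"
    unfolding component_expand[OF y j]
    using i component_f_in_T[OF _ j] component_props(1)[OF y] by (intro component_sum T_closed(3))
  also have "\<dots> = (\<Sum>l\<in>ix (n + m). pa_scale (?c l) (component (n + m) l y))"
    using i component_f_in_T[OF _ j] component_props(1)[OF y] cc cs
    by (intro sum.cong) (simp_all add: component_mult)
  finally show ?thesis .
qed

section \<open>Homomorphisms and Ext\<close>

text \<open>A common form for the targets \<open>N\<close> and \<open>F r\<close>: a module whose
  elements are images under \<open>\<kappa>\<close> of elements of kQ, with sums and the action
  computed on these.\<close>

definition presented_by :: "(_, 'b) module \<Rightarrow> (('v, 'a) qpath \<Rightarrow>\<^sub>0 'k) set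
    \<Rightarrow> ((('v, 'a) qpath \<Rightarrow>\<^sub>0 'k) \<Rightarrow> 'b) \<Rightarrow> bool" where
  "presented_by M S \<kappa> \<longleftrightarrow> carrier M = \<kappa> ` S \<and> 0 \<in> S \<and> (\<forall>x\<in>S. \<forall>y\<in>S. x + y \<in> S) \<and>
     (\<forall>x\<in>S. \<forall>a\<in>K. x \<star> a \<in> S) \<and>
     (\<forall>x\<in>S. \<forall>y\<in>S. \<kappa> x \<oplus>\<^bsub>M\<^esub> \<kappa> y = \<kappa> (x + y)) \<and> (\<forall>x\<in>S. \<forall>a\<in>K. q a \<odot>\<^bsub>M\<^esub> \<kappa> x = \<kappa> (x \<star> a))"

lemma presented_N: "presented_by N K rho"
  by (auto simp: presented_by_def top_module_simps)

lemma presented_F: "presented_by (F n) (T n) (cl n)"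
  by (auto simp: presented_by_def res_module_simps T_closed)

text \<open>The map on classes uses a chosen representative; it is meaningful when
  \<open>\<phi>\<close> is constant on classes, see \<open>induced_cl\<close>.\<close>

definition induced :: "nat \<Rightarrow> ((('v, 'a) qpath \<Rightarrow>\<^sub>0 'k) \<Rightarrow> 'b) \<Rightarrow> (('v, 'a) qpath \<Rightarrow>\<^sub>0 'k) set \<Rightarrow> 'b" where
  "induced n \<phi> = (\<lambda>z\<in>carrier (F n). \<phi> (SOME y. y \<in> T n \<and> cl n y = z))"

lemma induced_cl:
  assumes "\<And>x y. \<lbrakk>x \<in> T n; y \<in> T n; x - y \<in> B n\<rbrakk> \<Longrightarrow> \<phi> x = \<phi> y" and x: "x \<in> T n"
  shows "induced n \<phi> (cl n x) = \<phi> x"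
proof -
  have "\<exists>y. y \<in> T n \<and> cl n y = cl n x" using x by blast
  then have "(SOME y. y \<in> T n \<and> cl n y = cl n x) \<in> T n \<and> cl n (SOME y. y \<in> T n \<and> cl n y = cl n x) = cl n x"
    by (rule someI_ex)
  then have "\<phi> (SOME y. y \<in> T n \<and> cl n y = cl n x) = \<phi> x"
    using assms by (simp add: cl_eq_iff)
  then show ?thesis using x by (simp add: induced_def res_module_simps)
qed

text \<open>The map is split into \<open>\<phi>\<close> followed by \<open>\<kappa>\<close>:
  linearity is checked inside kQ, while independence of the representative is asked after
  \<open>\<kappa>\<close>.\<close>

lemma induced_hom:
  assumes M: "presented_by M S \<kappa>"
    and S: "\<And>x. x \<in> T n \<Longrightarrow> \<phi> x \<in> S"
    and add: "\<And>x y. \<lbrakk>x \<in> T n; y \<in> T n\<rbrakk> \<Longrightarrow> \<phi> (x + y) = \<phi> x + \<phi> y"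
    and mult: "\<And>x a. \<lbrakk>x \<in> T n; a \<in> K\<rbrakk> \<Longrightarrow> \<phi> (x \<star> a) = \<phi> x \<star> a"
    and wd: "\<And>x y. \<lbrakk>x \<in> T n; y \<in> T n; x - y \<in> B n\<rbrakk> \<Longrightarrow> \<kappa> (\<phi> x) = \<kappa> (\<phi> y)"
  shows "induced n (\<lambda>x. \<kappa> (\<phi> x)) \<in> right_hom \<Lambda> (F n) M"
    and "x \<in> T n \<Longrightarrow> induced n (\<lambda>x. \<kappa> (\<phi> x)) (cl n x) = \<kappa> (\<phi> x)"
proof -
  show cl: "induced n (\<lambda>x. \<kappa> (\<phi> x)) (cl n x) = \<kappa> (\<phi> x)" if "x \<in> T n" for x
    by (rule induced_cl[OF wd that])
  have "induced n (\<lambda>x. \<kappa> (\<phi> x)) \<in> carrier (F n) \<rightarrow>\<^sub>E carrier M"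
  proof (rule PiE_I)
    show "induced n (\<lambda>x. \<kappa> (\<phi> x)) z \<in> carrier M" if "z \<in> carrier (F n)" for z
      using that M S cl by (auto simp: res_module_simps presented_by_def)
  qed (simp add: induced_def)
  then show "induced n (\<lambda>x. \<kappa> (\<phi> x)) \<in> right_hom \<Lambda> (F n) M"
    using M S cl by (auto simp: right_hom_def res_module_simps quiver_algebra_simps presented_by_def
        T_closed add mult)
qed

lemma right_hom_eqI:
  assumes "h \<in> right_hom \<Lambda> (F n) M" "h' \<in> right_hom \<Lambda> (F n) M"
    "\<And>x. x \<in> T n \<Longrightarrow> h (cl n x) = h' (cl n x)"
  shows "h = h'"
  using assms by (intro extensionalityI[of h "carrier (F n)"])
    (auto simp: right_hom_def PiE_def res_module_simps)

text \<open>The classes of the \<open>f n i\<close> generate \<open>F n\<close>. The formula uses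
  lifts \<open>g i\<close> of their images to kQ, so that path lengths remain visible.\<close>

lemma right_hom_expand:
  assumes h: "h \<in> right_hom \<Lambda> (F n) M" and M: "presented_by M S \<kappa>"
    and g: "\<And>i. i \<in> ix n \<Longrightarrow> g i \<in> S" "\<And>i. i \<in> ix n \<Longrightarrow> h (cl n (f n i)) = \<kappa> (g i)"
    and y: "y \<in> T n"
  shows "h (cl n y) = \<kappa> (\<Sum>i\<in>ix n. g i \<star> component n i y)"
proof -
  have hadd: "h (cl n (x + y)) = h (cl n x) \<oplus>\<^bsub>M\<^esub> h (cl n y)" if "x \<in> T n" "y \<in> T n" for x y
    using h that by (auto simp: right_hom_def res_module_simps)
  have hmult: "h (cl n (x \<star> a)) = q a \<odot>\<^bsub>M\<^esub> h (cl n x)" if "x \<in> T n" "a \<in> K" for x a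
    using h that by (auto simp: right_hom_def res_module_simps quiver_algebra_simps)
  have hM: "h (cl n x) \<in> \<kappa> ` S" if "x \<in> T n" for x
    using h M that by (auto simp: right_hom_def res_module_simps presented_by_def)
  have Mmult: "q a \<odot>\<^bsub>M\<^esub> \<kappa> x = \<kappa> (x \<star> a)" "x \<star> a \<in> S" if "x \<in> S" "a \<in> K" for x a
    using M that by (auto simp: presented_by_def)
  have Madd: "\<kappa> x \<oplus>\<^bsub>M\<^esub> \<kappa> y = \<kappa> (x + y)" "x + y \<in> S" if "x \<in> S" "y \<in> S" for x y
    using M that by (auto simp: presented_by_def)
  note K = component_props(1)[OF y]
  have "h (cl n (\<Sum>i\<in>A. f n i \<star> component n i y)) = \<kappa> (\<Sum>i\<in>A. g i \<star> component n i y) \<and>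
      (\<Sum>i\<in>A. g i \<star> component n i y) \<in> S" if "finite A" "A \<subseteq> ix n" for A
    using that
  proof (induction A rule: finite_induct)
    case empty
    \<comment> \<open>The zero class is treated as \<open>0 \<star> 0\<close>, so that its image is
      \<open>q 0\<close> acting on some \<open>\<kappa> x\<close>, which is
      \<open>\<kappa> 0\<close>.\<close>
    obtain x where x: "x \<in> S" "h (cl n 0) = \<kappa> x" using hM[of 0] by (auto simp: T_closed)
    have "h (cl n 0) = \<kappa> 0" using hmult[of 0 0] Mmult(1)[of x 0] x by (simp add: T_closed)
    then show ?case using M by (simp add: presented_by_def)
  next
    case (insert i A)
    then have i: "i \<in> ix n" by simp
    have "h (cl n (f n i \<star> component n i y)) = \<kappa> (g i \<star> component n i y)"
      using hmult[OF f_in_T[OF i] K[OF i]] g[OF i] Mmult(1)[of "g i"] K[OF i] by simp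
    moreover have "f n i \<star> component n i y \<in> T n" "(\<Sum>i\<in>A. f n i \<star> component n i y) \<in> T n"
      using insert.prems K by (auto intro!: T_sum T_closed(3) f_in_T)
    moreover have "g i \<star> component n i y \<in> S" using g(1)[OF i] K[OF i] by (rule Mmult(2))
    ultimately show ?case using insert by (simp add: hadd Madd)
  qed
  from this[OF finite_ix order_refl] show ?thesis by (simp add: component_props(3)[OF y])
qed

text \<open>Since \<open>f n i\<close> is fixed by its end vertex on the right, so is its image;
  modulo \<open>L 1\<close> this leaves a multiple of one trivial path.\<close>

lemma right_hom_N_values:
  assumes h: "h \<in> right_hom \<Lambda> (F n) N" and i: "i \<in> ix n"
  shows "\<exists>a. h (cl n (f n i)) = rho (pa_scale a (e (tm n i)))"
proof -
  have "h (cl n (f n i)) \<in> carrier N"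
    using h f_in_T[OF i] by (auto simp: right_hom_def res_module_simps)
  then obtain x where x: "x \<in> K" "h (cl n (f n i)) = rho x" by (auto simp: top_module_simps)
  have "h (cl n (f n i \<star> e (tm n i))) = q (e (tm n i)) \<odot>\<^bsub>N\<^esub> h (cl n (f n i))"
    using h f_in_T[OF i] i by (auto simp: right_hom_def res_module_simps quiver_algebra_simps
        simp flip: res_module_simps(3))
  then have 1: "h (cl n (f n i)) = rho (x \<star> e (tm n i))"
    using x i by (simp add: terminus_props(3) top_module_simps)
  let ?a = "Poly_Mapping.lookup x (tm n i, [])"
  have "x \<star> e (tm n i) - pa_scale ?a (e (tm n i)) \<in> L 1"
  proof -
    have "Poly_Mapping.lookup (x \<star> e (tm n i) - pa_scale ?a (e (tm n i))) p = 0" if "length (snd p) = 0" for p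
      using that by (cases p)
        (auto simp: lookup_minus lookup_mult_vertex_elt lookup_vertex_elt)
    moreover have "x \<star> e (tm n i) - pa_scale ?a (e (tm n i)) \<in> K" using x i by auto
    ultimately show ?thesis by (force simp: length_ge_def in_keys_iff Suc_le_eq)
  qed
  with 1 show ?thesis by (auto simp: rho_eq_iff)
qed

text \<open>The linear combination of the dual homomorphisms with coefficients
  \<open>\<alpha>\<close>, in one formula on components. Its dependence on \<open>\<alpha>\<close>
  is through the values on \<open>ix n\<close>, see \<open>dual_sum_cong\<close>.\<close>

definition dual_sum :: "nat \<Rightarrow> (nat \<Rightarrow> 'k) \<Rightarrow> (('v, 'a) qpath \<Rightarrow>\<^sub>0 'k) set \<Rightarrow> (('v, 'a) qpath \<Rightarrow>\<^sub>0 'k) set set" where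
  "dual_sum n \<alpha> = induced n (\<lambda>y. rho (\<Sum>i\<in>ix n. pa_scale (\<alpha> i) (component n i y)))"

lemma dual_sum_extensional: "dual_sum n \<alpha> \<in> extensional (carrier (F n))"
  by (simp add: dual_sum_def induced_def)

lemma dual_sum_hom: "dual_sum n \<alpha> \<in> right_hom \<Lambda> (F n) N"
  and dual_sum_cl: "y \<in> T n \<Longrightarrow>
    dual_sum n \<alpha> (cl n y) = rho (\<Sum>i\<in>ix n. pa_scale (\<alpha> i) (component n i y))"
proof -
  let ?\<phi> = "\<lambda>y. \<Sum>i\<in>ix n. pa_scale (\<alpha> i) (component n i y)"
  have K: "?\<phi> x \<in> K" if "x \<in> T n" for x
    using that by (auto intro!: K_sum component_props(1))
  have add: "?\<phi> (x + y) = ?\<phi> x + ?\<phi> y" if "x \<in> T n" "y \<in> T n" for x y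
    using that by (simp add: component_add pa_scale_add sum.distrib)
  have mult: "?\<phi> (x \<star> a) = ?\<phi> x \<star> a" if "x \<in> T n" "a \<in> K" for x a
  proof -
    have "?\<phi> x \<star> a = (\<Sum>i\<in>ix n. pa_scale (\<alpha> i) (component n i x) \<star> a)"
      using that component_props(1) by (intro sum_distr(1)) auto
    then show ?thesis using that by (simp add: component_mult pa_scale_mult_left)
  qed
  \<comment> \<open>The components of an element of \<open>B n\<close> lie in \<open>I\<close>,
    hence in \<open>L 1\<close>, which \<open>rho\<close> annihilates.\<close>
  have wd: "rho (?\<phi> x) = rho (?\<phi> y)" if "x \<in> T n" "y \<in> T n" "x - y \<in> B n" for x y
  proof -
    have "?\<phi> (x - y) \<in> L 1"
      using that(3) I_subset_L1 by (auto simp: mem_B_iff intro!: length_ge_sum length_ge_closed(4))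
    moreover have "?\<phi> x = ?\<phi> (x - y) + ?\<phi> y" using add[of "x - y" y] that by (simp add: T_closed)
    ultimately show ?thesis by (simp add: rho_eq_iff)
  qed
  show "dual_sum n \<alpha> \<in> right_hom \<Lambda> (F n) N"
    "y \<in> T n \<Longrightarrow> dual_sum n \<alpha> (cl n y) = rho (?\<phi> y)"
    unfolding dual_sum_def using induced_hom[OF presented_N K add mult wd] by auto
qed

text \<open>By \<open>right_hom_N_values\<close> a homomorphism amounts to one scalar for each
  generator, and these scalars are the coefficients.\<close>

lemma right_hom_N_eq: "right_hom \<Lambda> (F n) N = range (dual_sum n)"
proof (intro equalityI subsetI)
  fix h assume h: "h \<in> right_hom \<Lambda> (F n) N"
  then obtain \<alpha> where \<alpha>: "\<And>i. i \<in> ix n \<Longrightarrow> h (cl n (f n i)) = rho (pa_scale (\<alpha> i) (e (tm n i)))"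
    using right_hom_N_values by metis
  have "h (cl n y) = dual_sum n \<alpha> (cl n y)" if "y \<in> T n" for y
    using right_hom_expand[OF h presented_N _ \<alpha> that] that
    by (simp add: dual_sum_cl pa_scale_mult_left component_props(2))
  then have "h = dual_sum n \<alpha>" by (rule right_hom_eqI[OF h dual_sum_hom])
  then show "h \<in> range (dual_sum n)" by simp
qed (auto simp: dual_sum_hom)

lemma dual_sum_cong: "(\<And>i. i \<in> ix n \<Longrightarrow> \<alpha> i = \<beta> i) \<Longrightarrow> dual_sum n \<alpha> = dual_sum n \<beta>"
  by (rule right_hom_eqI[OF dual_sum_hom dual_sum_hom]) (simp add: dual_sum_cl)

lemma dual_sum_f: "i \<in> ix n \<Longrightarrow> dual_sum n \<alpha> (cl n (f n i)) = rho (pa_scale (\<alpha> i) (e (tm n i)))"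
  by (simp add: dual_sum_cl f_in_T component_f if_distrib cong: if_cong)

text \<open>Evaluation at \<open>f n i\<close> gives a multiple of a vertex, and a nonzero multiple
  is not in \<open>L 1\<close>.\<close>

lemma dual_sum_inject:
  assumes "dual_sum n \<alpha> = dual_sum n \<beta>" "i \<in> ix n"
  shows "\<alpha> i = \<beta> i"
proof (rule ccontr)
  assume "\<alpha> i \<noteq> \<beta> i"
  have "rho (pa_scale (\<alpha> i) (e (tm n i))) = rho (pa_scale (\<beta> i) (e (tm n i)))"
    using dual_sum_f[OF assms(2)] assms(1) by metis
  then have "pa_scale (\<alpha> i) (e (tm n i)) - pa_scale (\<beta> i) (e (tm n i)) \<in> L 1"
    by (simp only: rho_eq_iff)
  moreover have "(tm n i, []) \<in> Poly_Mapping.keys (pa_scale (\<alpha> i) (e (tm n i)) - pa_scale (\<beta> i) (e (tm n i)))"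
    using \<open>\<alpha> i \<noteq> \<beta> i\<close> by (simp add: in_keys_iff lookup_minus vertex_elt_def)
  ultimately show False by (force simp: length_ge_def)
qed

text \<open>Kronecker coefficients satisfy the definite description; uniqueness holds because a
  homomorphism is determined by its values on the generators.\<close>

lemma dual_hom_eq:
  assumes i: "i \<in> ix n"
  shows "dual_hom Q I t f n i = dual_sum n (\<lambda>j. if j = i then 1 else 0)"
proof -
  have val: "(if i = j then top_proj Q I (I +>\<^bsub>path_algebra Q\<^esub> vertex_elt (terminus Q (f n i)))
      else \<zero>\<^bsub>N\<^esub>) = rho (pa_scale (if j = i then 1 else 0) (e (tm n j)))" if "j \<in> ix n" for j
  proof -
    have "pa_scale 1 x = x" for x :: "('v, 'a) qpath \<Rightarrow>\<^sub>0 'k" by (rule poly_mapping_eqI) simp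
    then show ?thesis using that by (auto simp: q_eq top_proj_q top_module_simps)
  qed
  have res: "res_class Q I t f n j = cl n (f n j)" for j
    by (simp add: res_class_def coset_altdef cl_def)
  show ?thesis
    unfolding dual_hom_def res
  proof (rule the_equality)
    show "dual_sum n (\<lambda>j. if j = i then 1 else 0) \<in> right_hom \<Lambda> (F n) N \<and>
      (\<forall>j\<in>ix n. dual_sum n (\<lambda>j. if j = i then 1 else 0) (cl n (f n j)) =
        (if i = j then top_proj Q I (I +>\<^bsub>path_algebra Q\<^esub> vertex_elt (terminus Q (f n i)))
         else \<zero>\<^bsub>N\<^esub>))"
      using val by (simp add: dual_sum_hom dual_sum_f)
    fix h assume h: "h \<in> right_hom \<Lambda> (F n) N \<and>
      (\<forall>j\<in>ix n. h (cl n (f n j)) =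
        (if i = j then top_proj Q I (I +>\<^bsub>path_algebra Q\<^esub> vertex_elt (terminus Q (f n i)))
         else \<zero>\<^bsub>N\<^esub>))"
    then obtain \<alpha> where \<alpha>: "h = dual_sum n \<alpha>" by (auto simp: right_hom_N_eq)
    let ?\<delta> = "\<lambda>j. if j = i then 1 else (0::'k)"
    have vals: "h (cl n (f n j)) = rho (pa_scale (?\<delta> j) (e (tm n j)))" if "j \<in> ix n" for j
      using h val[OF that] that by simp
    show "h = dual_sum n ?\<delta>"
    proof (rule right_hom_eqI[OF conjunct1[OF h] dual_sum_hom])
      fix y assume y: "y \<in> T n"
      show "h (cl n y) = dual_sum n ?\<delta> (cl n y)"
        using right_hom_expand[OF conjunct1[OF h] presented_N _ vals y] y
        by (simp add: dual_sum_cl pa_scale_mult_left component_props(2))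
    qed
  qed
qed

lemma dual_hom_cl:
  assumes "i \<in> ix n" "y \<in> T n"
  shows "dual_hom Q I t f n i (cl n y) = rho (component n i y)"
proof -
  have "(\<Sum>j\<in>ix n. pa_scale (if j = i then 1 else 0) (component n j y)) =
      (\<Sum>j\<in>ix n. if j = i then component n i y else 0)"
    by (rule sum.cong) (auto intro!: poly_mapping_eqI)
  then show ?thesis using assms by (simp add: dual_hom_eq dual_sum_cl)
qed

text \<open>Elements of length above \<open>n\<close> have components in \<open>L 1\<close>, which
  vanish in the top of \<Lambda>.\<close>

lemma dual_sum_vanish:
  assumes "y \<in> T n" "y \<in> L (Suc n)"
  shows "dual_sum n \<alpha> (cl n y) = rho 0"
proof -
  have "(\<Sum>i\<in>ix n. pa_scale (\<alpha> i) (component n i y)) \<in> L 1"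
    using component_L[of y n 1] assms by (auto intro!: length_ge_sum length_ge_closed(4))
  then show ?thesis using assms by (simp add: dual_sum_cl rho_eq_iff)
qed

section \<open>The spaces Ext, identified with spaces of homomorphisms\<close>

abbreviation \<iota> where "\<iota> \<equiv> algebra_scalar Q I"

abbreviation V where "V n \<equiv> hom_space \<iota> \<Lambda> (F n) N"

lemma dual_sum_zero: "dual_sum n (\<lambda>_. 0) = (\<lambda>x\<in>carrier (F n). rho 0)"
  by (rule extensionalityI[OF dual_sum_extensional]) (auto simp: res_module_simps dual_sum_cl)

lemma hom_space_simps:
  "dual_sum n \<alpha> \<oplus>\<^bsub>V n\<^esub> dual_sum n \<beta> = dual_sum n (\<lambda>i. \<alpha> i + \<beta> i)"
  "a \<odot>\<^bsub>V n\<^esub> dual_sum n \<alpha> = dual_sum n (\<lambda>i. a * \<alpha> i)"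
proof -
  show "dual_sum n \<alpha> \<oplus>\<^bsub>V n\<^esub> dual_sum n \<beta> = dual_sum n (\<lambda>i. \<alpha> i + \<beta> i)"
  proof (rule extensionalityI[of _ "carrier (F n)", OF _ dual_sum_extensional])
    fix z assume "z \<in> carrier (F n)"
    then obtain y where y: "y \<in> T n" "z = cl n y" by (auto simp: res_module_simps)
    have "pa_scale (\<alpha> i + \<beta> i) x = pa_scale (\<alpha> i) x + pa_scale (\<beta> i) x" for i and x :: "('v, 'a) qpath \<Rightarrow>\<^sub>0 'k"
      by (rule poly_mapping_eqI) (simp add: lookup_add algebra_simps)
    with y show "(dual_sum n \<alpha> \<oplus>\<^bsub>V n\<^esub> dual_sum n \<beta>) z = dual_sum n (\<lambda>i. \<alpha> i + \<beta> i) z"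
      by (simp add: hom_space_def dual_sum_cl top_module_simps res_module_simps sum.distrib)
  qed (simp add: hom_space_def)
  show "a \<odot>\<^bsub>V n\<^esub> dual_sum n \<alpha> = dual_sum n (\<lambda>i. a * \<alpha> i)"
  proof (rule extensionalityI[of _ "carrier (F n)", OF _ dual_sum_extensional])
    fix z assume "z \<in> carrier (F n)"
    then obtain y where y: "y \<in> T n" "z = cl n y" by (auto simp: res_module_simps)
    have "pa_scale (a * \<alpha> i) x = pa_scale a (pa_scale (\<alpha> i) x)" for i and x :: "('v, 'a) qpath \<Rightarrow>\<^sub>0 'k"
      by (rule poly_mapping_eqI) (simp add: algebra_simps)
    moreover have "(\<Sum>i\<in>ix n. pa_scale (\<alpha> i) (component n i y)) \<in> K"
      using y by (auto intro!: K_sum component_props(1))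
    ultimately show "(a \<odot>\<^bsub>V n\<^esub> dual_sum n \<alpha>) z = dual_sum n (\<lambda>i. a * \<alpha> i) z"
      using y by (simp add: hom_space_def dual_sum_cl top_module_simps res_module_simps
          algebra_scalar_eq mul_pa_scale_one pa_scale_sum)
  qed (simp add: hom_space_def)
qed

text \<open>The differential lands one length further up, so by \<open>dual_sum_vanish\<close> every
  homomorphism to \<open>N\<close> is a cocycle and every coboundary is zero.\<close>

lemma f_Suc_in_L: "y \<in> T (Suc n) \<Longrightarrow> y \<in> T n \<and> y \<in> L (Suc n)"
  using T_Suc T_in_L by blast

lemma cocycles_eq: "cocycles \<Lambda> (\<lambda>n. F n) d N n = range (dual_sum n)"
  by (auto simp: cocycles_def right_hom_N_eq res_module_simps(1) res_diff_cl f_Suc_in_L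
      dual_sum_vanish top_module_simps)

lemma coboundaries_eq: "coboundaries \<Lambda> (\<lambda>n. F n) d N n = {dual_sum n (\<lambda>_. 0)}"
proof (cases n)
  case 0
  then show ?thesis by (simp add: coboundaries_def dual_sum_zero top_module_simps)
next
  case (Suc l)
  have "compose (carrier (F (Suc l))) (dual_sum l \<alpha>) (d (Suc l)) = dual_sum (Suc l) (\<lambda>_. 0)" for \<alpha>
    unfolding dual_sum_zero
    by (rule ext) (auto simp: compose_def res_module_simps(1) res_diff_cl f_Suc_in_L dual_sum_vanish)
  then have "{compose (carrier (F (Suc l))) y (d (Suc l)) |y. y \<in> range (dual_sum l)} =
      {dual_sum (Suc l) (\<lambda>_. 0)}"
    by (simp add: setcompr_eq_image image_image)
  then show ?thesis using Suc by (simp add: coboundaries_def right_hom_N_eq)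
qed

text \<open>With the zero map as the only coboundary, each class is a singleton, and Ext is computed
  on representatives.\<close>

lemma ext_class_eq: "ext_class \<iota> \<Lambda> (\<lambda>n. F n) d N n (dual_sum n \<alpha>) = {dual_sum n \<alpha>}"
  by (simp add: ext_class_def coboundaries_eq a_r_coset_def r_coset_def hom_space_simps)

abbreviation E where "E n \<equiv> Ext Q I t f n"

lemma Ext_simps:
  "carrier (E n) = range (\<lambda>\<alpha>. {dual_sum n \<alpha>})"
  "\<zero>\<^bsub>E n\<^esub> = {dual_sum n (\<lambda>_. 0)}"
  "{dual_sum n \<alpha>} \<oplus>\<^bsub>E n\<^esub> {dual_sum n \<beta>} = {dual_sum n (\<lambda>i. \<alpha> i + \<beta> i)}"
  "a \<odot>\<^bsub>E n\<^esub> {dual_sum n \<alpha>} = {dual_sum n (\<lambda>i. a * \<alpha> i)}"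
  by (simp_all add: Ext_def ext_space_def cocycles_eq coboundaries_eq ext_class_eq set_add_def
      set_mult_def hom_space_simps image_image)

lemma dual_class_eq: "i \<in> ix n \<Longrightarrow> dual_class Q I t f n i = {dual_sum n (\<lambda>j. if j = i then 1 else 0)}"
  by (simp add: dual_class_def dual_hom_eq ext_class_eq)

lemma abelian_monoid_Ext: "abelian_monoid (E n)"
  by (rule abelian_monoidI) (auto simp: Ext_simps algebra_simps)

text \<open>Used twice: it reduces the basis property to \<open>dual_sum_inject\<close> and the
  description of Ext, and it evaluates the right-hand side of the product formula.\<close>

lemma finsum_Ext:
  "(\<Oplus>\<^bsub>E n\<^esub>i\<in>ix n. \<alpha> i \<odot>\<^bsub>E n\<^esub> dual_class Q I t f n i) = {dual_sum n \<alpha>}"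
proof -
  interpret E: abelian_monoid "E n" by (rule abelian_monoid_Ext)
  have "(\<Oplus>\<^bsub>E n\<^esub>i\<in>A. \<alpha> i \<odot>\<^bsub>E n\<^esub> dual_class Q I t f n i) =
      {dual_sum n (\<lambda>i. if i \<in> A then \<alpha> i else 0)}" if "finite A" "A \<subseteq> ix n" for A
    using that
  proof (induction A rule: finite_induct)
    case empty
    then show ?case by (simp add: Ext_simps)
  next
    case (insert j A)
    have closed: "\<alpha> i \<odot>\<^bsub>E n\<^esub> dual_class Q I t f n i \<in> carrier (E n)" if "i \<in> ix n" for i
      using that by (auto simp: dual_class_eq Ext_simps)
    have "(\<Oplus>\<^bsub>E n\<^esub>i\<in>insert j A. \<alpha> i \<odot>\<^bsub>E n\<^esub> dual_class Q I t f n i) =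
        \<alpha> j \<odot>\<^bsub>E n\<^esub> dual_class Q I t f n j \<oplus>\<^bsub>E n\<^esub> (\<Oplus>\<^bsub>E n\<^esub>i\<in>A. \<alpha> i \<odot>\<^bsub>E n\<^esub> dual_class Q I t f n i)"
      using insert closed by (intro E.finsum_insert) auto
    also have "\<dots> = {dual_sum n (\<lambda>i. \<alpha> j * (if i = j then 1 else 0) + (if i \<in> A then \<alpha> i else 0))}"
      using insert by (simp add: dual_class_eq Ext_simps)
    also have "\<dots> = {dual_sum n (\<lambda>i. if i \<in> insert j A then \<alpha> i else 0)}"
      using insert by (auto intro!: dual_sum_cong)
    finally show ?case .
  qed
  from this[OF finite_ix order_refl] show ?thesis by (auto intro!: dual_sum_cong)
qed

lemma is_basis_Ext: "is_basis (E n) (ix n) (dual_class Q I t f n)"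
  unfolding is_basis_def finsum_Ext
  by (auto simp: dual_class_eq Ext_simps dest: dual_sum_inject)

section \<open>Liftings of the dual homomorphisms and the Yoneda product\<close>

lemma T_0: "T 0 = K"
  using defines_resolution by (simp add: defines_minimal_resolution_def)

text \<open>Together with \<open>T_0\<close> this makes \<open>F 0\<close> equal to \<Lambda> on the
  level of classes, so that \<open>top_proj\<close> can be evaluated on it.\<close>

lemma B_0: "B 0 = I"
proof (intro equalityI subsetI)
  show "x \<in> B 0" if "x \<in> I" for x
    using T_mult_I[of one_K 0 x] that I_closed(2) by (simp add: T_0)
  fix x assume "x \<in> B 0"
  then obtain s where s: "x = (\<Sum>i\<in>ix 0. f 0 i \<star> s i)" "\<And>i. i \<in> ix 0 \<Longrightarrow> s i \<in> I"
    using B_E by blast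
  have "(\<Sum>i\<in>A. f 0 i \<star> s i) \<in> I" if "finite A" "A \<subseteq> ix 0" for A
    using that s(2) by (induction A rule: finite_induct) (auto intro!: I_closed(1,3,6))
  then show "x \<in> I" using s(1) by simp
qed

lemma cl_0: "cl 0 x = q x"
  by (simp add: cl_def q_def B_0)

text \<open>
  In the induction step, \<open>y\<close> is a combination of the \<open>f\<^sup>n\<^sup>+\<^sup>r\<^sub>p\<close> with coefficients in the arrow
  ideal, so the error term moves to longer paths.
\<close>

lemma lifting_leading_term:
  assumes g: "g \<in> liftings \<Lambda> (\<lambda>n. F n) d (top_proj Q I) n (dual_hom Q I t f n j)"
    and j: "j \<in> ix n" and y: "y \<in> T (n + r)"
  shows "\<exists>w\<in>T r. g r (cl (n + r) y) = cl r w \<and> w - component n j y \<in> L (Suc r)"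
proof -
  have hom: "g r \<in> right_hom \<Lambda> (F (n + r)) (F r)" for r
    using g by (simp add: liftings_def)
  have mem: "\<exists>w\<in>T r. g r (cl (n + r) y) = cl r w" if "y \<in> T (n + r)" for r y
  proof -
    have "g r (cl (n + r) y) \<in> cl r ` T r"
      using hom[of r] that by (auto simp: right_hom_def res_module_simps)
    then show ?thesis by blast
  qed
  show ?thesis
    using y
  proof (induction r arbitrary: y)
    case (0 y)
    then obtain w where w: "w \<in> T 0" "g 0 (cl n y) = cl 0 w" using mem[of y 0] by auto
    have "y \<in> T n" using 0 by simp
    have "top_proj Q I (g 0 (cl n y)) = rho w"
      using w T_in_K[OF w(1)] top_proj_q[of w] by (simp add: cl_0)
    moreover have "top_proj Q I (g 0 (cl n y)) = dual_hom Q I t f n j (cl n y)"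
      using g \<open>y \<in> T n\<close> by (auto simp: liftings_def res_module_simps)
    ultimately have "rho w = rho (component n j y)"
      using dual_hom_cl[OF j \<open>y \<in> T n\<close>] by simp
    then have "w - component n j y \<in> L 1" by (simp only: rho_eq_iff)
    with w show ?case by auto
  next
    case (Suc r y)
    then obtain w where w: "w \<in> T (Suc r)" "g (Suc r) (cl (n + Suc r) y) = cl (Suc r) w"
      using mem by blast
    have y: "y \<in> T (Suc (n + r))" using Suc.prems by simp
    then have yT: "y \<in> T (n + r)" and yL: "y \<in> L (n + r + 1)" using f_Suc_in_L by auto
    have "g r (d (Suc (n + r)) (cl (Suc (n + r)) y)) = d (Suc r) (g (Suc r) (cl (Suc (n + r)) y))"
      using g y by (auto simp: liftings_def res_module_simps(1))
    \<comment> \<open>Differentials are induced by inclusions, so the representative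
      \<open>w\<close> of the image in degree \<open>Suc r\<close> also represents the image in
      degree \<open>r\<close>.\<close>
    then have gy: "g r (cl (n + r) y) = cl r w"
      using w y by (simp add: res_diff_cl)
    have "\<exists>v. v \<in> T r \<and> g r (cl (n + r) (f (n + r) p)) = cl r v \<and>
        v - component n j (f (n + r) p) \<in> L (Suc r)" if "p \<in> ix (n + r)" for p
      using Suc.IH[OF f_in_T[OF that]] by blast
    then obtain v where v: "\<And>p. p \<in> ix (n + r) \<Longrightarrow> v p \<in> T r"
      "\<And>p. p \<in> ix (n + r) \<Longrightarrow> g r (cl (n + r) (f (n + r) p)) = cl r (v p)"
      "\<And>p. p \<in> ix (n + r) \<Longrightarrow> v p - component n j (f (n + r) p) \<in> L (Suc r)"
      by metis
    let ?u = "\<lambda>p. component (n + r) p y"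
    \<comment> \<open>All paths of \<open>y\<close> are longer than \<open>n + r\<close>, so the
      coefficients lie in the arrow ideal.\<close>
    have u: "?u p \<in> L 1" if "p \<in> ix (n + r)" for p using component_L[OF yT yL that] .
    have "g r (cl (n + r) y) = cl r (\<Sum>p\<in>ix (n + r). v p \<star> ?u p)"
      by (rule right_hom_expand[OF hom presented_F v(1,2) yT])
    \<comment> \<open>The two representatives differ by an element of \<open>B r\<close>, and
      \<open>B r\<close> lies in \<open>L (r + 2)\<close>.\<close>
    then have 1: "w - (\<Sum>p\<in>ix (n + r). v p \<star> ?u p) \<in> L (Suc (Suc r))"
      using gy B_in_L[of _ r] by (simp add: cl_eq_iff)
    \<comment> \<open>The induction hypothesis bounds the error at each generator by
      \<open>L (Suc r)\<close>; a coefficient in \<open>L 1\<close> raises this by one.\<close>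
    have "(\<Sum>p\<in>ix (n + r). (v p - component n j (f (n + r) p)) \<star> ?u p) \<in> L (Suc (Suc r))"
      using L_mult[OF v(3) u] by (intro length_ge_sum) simp
    moreover have "(\<Sum>p\<in>ix (n + r). (v p - component n j (f (n + r) p)) \<star> ?u p) =
        (\<Sum>p\<in>ix (n + r). v p \<star> ?u p) - component n j y"
      unfolding component_expand[OF yT j] sum_subtractf[symmetric]
      using v(1) T_in_K component_f_in_T[OF _ j] u L_in_K
      by (intro sum.cong refl distr(3)) blast+
    ultimately have 2: "(\<Sum>p\<in>ix (n + r). v p \<star> ?u p) - component n j y \<in> L (Suc (Suc r))"
      by (simp only:)
    have "w - component n j y \<in> L (Suc (Suc r))"
      using length_ge_closed(2)[OF 1 2] by simp
    with w show ?case by blast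
  qed
qed

text \<open>One map, \<open>component n j\<close>, serves in all degrees and so commutes with the
  inclusions. Existence keeps the union in \<open>yoneda_product\<close> from being empty.\<close>

lemma lifting_exists:
  assumes j: "j \<in> ix n"
  shows "(\<lambda>r. induced (n + r) (\<lambda>y. cl r (component n j y)))
    \<in> liftings \<Lambda> (\<lambda>n. F n) d (top_proj Q I) n (dual_hom Q I t f n j)"
proof -
  let ?g = "\<lambda>r. induced (n + r) (\<lambda>y. cl r (component n j y))"
  have T: "x \<in> T n" if "x \<in> T (n + r)" for x r using that T_add by blast
  have wd: "cl r (component n j x) = cl r (component n j y)"
    if "x \<in> T (n + r)" "y \<in> T (n + r)" "x - y \<in> B (n + r)" for r x y
    using component_in_B[OF that(3) j] j T[OF that(1)] T[OF that(2)]
    by (simp add: cl_eq_iff component_diff)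
  have S: "component n j x \<in> T r" if "x \<in> T (n + r)" for r x
    by (rule component_in_T[OF that j])
  have add: "component n j (x + y) = component n j x + component n j y"
    if "x \<in> T (n + r)" "y \<in> T (n + r)" for r x y
    by (rule component_add[OF T[OF that(1)] T[OF that(2)] j])
  have mult: "component n j (x \<star> a) = component n j x \<star> a" if "x \<in> T (n + r)" "a \<in> K" for r x a
    by (rule component_mult[OF T[OF that(1)] that(2) j])
  have hom: "?g r \<in> right_hom \<Lambda> (F (n + r)) (F r)" for r
    by (rule induced_hom(1)[OF presented_F]; rule S add mult wd; assumption)
  have val: "?g r (cl (n + r) x) = cl r (component n j x)" if "x \<in> T (n + r)" for r x
    by (rule induced_hom(2)[OF presented_F]; (rule S add mult wd; assumption | rule that))
  have "top_proj Q I (?g 0 z) = dual_hom Q I t f n j z" if "z \<in> carrier (F n)" for z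
  proof -
    obtain x where x: "x \<in> T n" "z = cl n x" using \<open>z \<in> carrier (F n)\<close> by (auto simp: res_module_simps)
    have "?g 0 z = q (component n j x)" using val[of x 0] x by (simp add: cl_0)
    then show ?thesis
      using x j component_props(1)[OF x(1) j] by (simp add: top_proj_q dual_hom_cl)
  qed
  moreover have "?g r (d (n + r + 1) z) = d (r + 1) (?g (r + 1) z)"
    if "z \<in> carrier (F (n + r + 1))" for r z
  proof -
    obtain x where x: "x \<in> T (Suc (n + r))" "z = cl (Suc (n + r)) x"
      using \<open>z \<in> carrier (F (n + r + 1))\<close> by (auto simp: res_module_simps)
    have "?g r (d (n + r + 1) z) = cl r (component n j x)"
      using x val[of x r] f_Suc_in_L by (simp add: res_diff_cl)
    moreover have "?g (r + 1) z = cl (Suc r) (component n j x)"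
      using x val[of x "Suc r"] by simp
    moreover have "component n j x \<in> T (Suc r)" using component_in_T[of x n "Suc r"] x j by simp
    ultimately show ?thesis by (simp add: res_diff_cl)
  qed
  ultimately show ?thesis using hom by (simp add: liftings_def)
qed

text \<open>An arbitrary lifting differs from \<open>component n j\<close> by
  \<open>L (Suc m)\<close>. Applying \<open>component m i\<close> sends this error to
  \<open>L 1\<close>, hence to zero in the top, and \<open>component_component\<close> evaluates
  what is left.\<close>

lemma compose_lifting:
  assumes g: "g \<in> liftings \<Lambda> (\<lambda>n. F n) d (top_proj Q I) n (dual_hom Q I t f n j)"
    and i: "i \<in> ix m" and j: "j \<in> ix n"
  shows "compose (carrier (F (m + n))) (dual_hom Q I t f m i) (g m) =
    dual_sum (m + n) (\<lambda>l. c j i (m + n) l n)"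
proof (rule extensionalityI[of _ "carrier (F (m + n))", OF _ dual_sum_extensional])
  fix z assume "z \<in> carrier (F (m + n))"
  then obtain y where y: "y \<in> T (n + m)" "z = cl (n + m) y"
    by (auto simp: res_module_simps add.commute)
  obtain w where w: "w \<in> T m" "g m (cl (n + m) y) = cl m w" "w - component n j y \<in> L (Suc m)"
    using lifting_leading_term[OF g j y(1)] by blast
  have cT: "component n j y \<in> T m" using component_in_T[OF y(1) j] .
  have "component m i (w - component n j y) \<in> L 1"
    using w cT i by (intro component_L) (auto simp: T_closed)
  then have "rho (component m i w) = rho (component m i (component n j y))"
    using w(1) cT i by (simp add: rho_eq_iff component_diff)
  also have "\<dots> = dual_sum (m + n) (\<lambda>l. c j i (m + n) l n) z"
    using y by (simp add: component_component[OF y(1) j i] dual_sum_cl add.commute)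
  finally show "compose (carrier (F (m + n))) (dual_hom Q I t f m i) (g m) z =
      dual_sum (m + n) (\<lambda>l. c j i (m + n) l n) z"
    using \<open>z \<in> carrier (F (m + n))\<close> w y by (simp add: compose_def dual_hom_cl[OF i])
qed (simp add: compose_def)

text \<open>Both classes are singletons, so the union runs over the liftings alone; there is at
  least one, and all give the same composite.\<close>

lemma Ext_mult_dual_class:
  assumes i: "i \<in> ix m" and j: "j \<in> ix n"
  shows "Ext_mult Q I t f m n (dual_class Q I t f m i) (dual_class Q I t f n j) =
    {dual_sum (m + n) (\<lambda>l. c j i (m + n) l n)}"
proof -
  have "Ext_mult Q I t f m n (dual_class Q I t f m i) (dual_class Q I t f n j) =
    (\<Union>g\<in>liftings \<Lambda> (\<lambda>n. F n) d (top_proj Q I) n (dual_hom Q I t f n j).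
       ext_class \<iota> \<Lambda> (\<lambda>n. F n) d N (m + n) (compose (carrier (F (m + n))) (dual_hom Q I t f m i) (g m)))"
    using i j by (simp add: Ext_mult_def yoneda_product_def dual_class_eq dual_hom_eq)
  also have "\<dots> = {dual_sum (m + n) (\<lambda>l. c j i (m + n) l n)}"
    using lifting_exists[OF j] compose_lifting[OF _ i j] by (auto simp: ext_class_eq)
  finally show ?thesis .
qed

end

theorem theorem3p1:
  fixes Q :: "('v, 'a) pre_digraph"
    and I :: "(('v, 'a) qpath \<Rightarrow>\<^sub>0 'k::field) set"
    and t :: "nat \<Rightarrow> int"
    and f :: "nat \<Rightarrow> nat \<Rightarrow> (('v, 'a) qpath \<Rightarrow>\<^sub>0 'k)"
    and c :: "nat \<Rightarrow> nat \<Rightarrow> nat \<Rightarrow> nat \<Rightarrow> nat \<Rightarrow> 'k"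
  assumes "fin_digraph Q"
    and "ideal I (path_algebra Q)"
    and "I \<subseteq> arrow_ideal Q \<cdot>\<^bsub>path_algebra Q\<^esub> arrow_ideal Q"
    and "koszul_algebra Q I"
    and "defines_minimal_resolution Q I t f"
    and "comultiplicative_structure Q t f c"
  shows "(\<forall>n. is_basis (Ext Q I t f n) (idx t n) (dual_class Q I t f n)) \<and>
    (\<forall>m n. \<forall>i\<in>idx t m. \<forall>j\<in>idx t n.
      Ext_mult Q I t f m n (dual_class Q I t f m i) (dual_class Q I t f n j) =
      (\<Oplus>\<^bsub>Ext Q I t f (m + n)\<^esub>l\<in>idx t (m + n).
         c j i (m + n) l n \<odot>\<^bsub>Ext Q I t f (m + n)\<^esub> dual_class Q I t f (m + n) l))"
proof -
  interpret resolution Q I t f c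
    by (intro resolution.intro quiver_ideal.intro resolution_axioms.intro) (rule assms)+
  show ?thesis
    using is_basis_Ext Ext_mult_dual_class finsum_Ext by simp
qed

end
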